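(* Let $G$ be a finite abelian group, let $\mathbf{k}$ be a field with $\operatorname{char}\mathbf{k}\nmid |G|$, and let $V$ be a faithful, finite-dimensional representation of $G$ over $\mathbf{k}$. Let $m$ be the number of distinct nontrivial characters of $G$ occurring in $V$, and assume $m\geq 1$. Then $$\gamma_{\mathrm{field}}(G,V) \geq \sqrt[m]{|G|}.$$
   Context: $\mathbf{k}[V]$ is the ring of polynomial functions on $V$, $\mathbf{k}(V)$ its fraction field, with $G$ acting by $(gf)(v)=f(g^{-1}v)$; $\mathbf{k}[V]^G$, $\mathbf{k}(V)^G$ are the invariants, and $\mathbf{k}[V]^G_{\leq d}$ is the space of invariant polynomials of degree at most $d$. $\gamma_{\mathrm{field}}(G,V)$ is the least natural number $d$ such that $\mathbf{k}(V)^G$ is a finite field extension of its subfield $\mathbf{k}(\mathbf{k}[V]^G_{\leq d})$ (equivalently, such that $\mathbf{k}[V]^G_{\leq d}$ contains a transcendence basis of $\mathbf{k}(V)$ over $\mathbf{k}$). The characters occurring in $V$ means the characters $G\to \mathbf{K}^\times$ occurring in $\mathbf{K}\otimes_{\mathbf{k}} V$, where $\mathbf{K}\supseteq \mathbf{k}$ is an extension field containing the $|G|$th roots of unity (so that the action on $\mathbf{K}\otimes_{\mathbf{k}}V$ is diagonalizable). *)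

theory Defs
  imports
    "HOL-Analysis.Analysis"
    "HOL-Library.Poly_Mapping"
    "HOL-Computational_Algebra.Fraction_Field"
    "HOL-Computational_Algebra.Normalized_Fraction"
    "HOL-Algebra.Group_Action"
    "HOL-Algebra.Multiplicative_Group"
    "HOL-Algebra.Generated_Fields"
    "HOL-Algebra.Embedded_Algebras"
    "HOL-Algebra.Algebraic_Closure_Type"
begin

text \<open>
  A representation of \<open>G\<close> on a vector space \<open>V\<close> of dimension \<open>n \<ge> 1\<close> enters the definitions
  through its matrices \<open>A g\<close> with respect to a basis of \<open>V\<close>; the basis is indexed by a finite
  type \<open>'n\<close> with \<open>n\<close> elements.
\<close>

definition matrix_wrt ::
  "('k::field \<Rightarrow> 'v::ab_group_add \<Rightarrow> 'v) \<Rightarrow> ('n::finite \<Rightarrow> 'v) \<Rightarrow> ('v \<Rightarrow> 'v) \<Rightarrow> 'k ^ 'n ^ 'n" where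
  "matrix_wrt sc b f =
     (\<chi> i j. module.representation sc (range b) (f (b j)) (b i))"


subsection \<open>The ring of polynomial functions and its fraction field\<close>

text \<open>
  \<open>k[V]\<close> is the (formal) polynomial ring over \<open>k\<close> in the coordinate functions \<open>x\<^sub>i\<close> dual to the
  chosen basis. So over a finite field, polynomials that agree as functions on the points of \<open>V\<close>
  are still different. The library proves that the polynomial ring is a domain only for linearly
  ordered index types; the order plays no other role.
\<close>

type_synonym ('n, 'k) mpoly = "('n \<Rightarrow>\<^sub>0 nat) \<Rightarrow>\<^sub>0 'k"

definition Const :: "'k::field \<Rightarrow> ('n, 'k) mpoly" where
  "Const c = Poly_Mapping.single 0 c"

definition Var :: "'n \<Rightarrow> ('n, 'k::field) mpoly" where
  "Var i = Poly_Mapping.single (Poly_Mapping.single i 1) 1"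

definition subst :: "('n \<Rightarrow> ('n, 'k) mpoly) \<Rightarrow> ('n, 'k::field) mpoly \<Rightarrow> ('n, 'k) mpoly" where
  "subst \<sigma> p =
     (\<Sum>t\<in>Poly_Mapping.keys p. Const (Poly_Mapping.lookup p t) *
        (\<Prod>i\<in>Poly_Mapping.keys t. \<sigma> i ^ Poly_Mapping.lookup t i))"

definition total_degree_le :: "nat \<Rightarrow> ('n::finite, 'k::field) mpoly \<Rightarrow> bool" where
  "total_degree_le d p \<longleftrightarrow>
     (\<forall>t\<in>Poly_Mapping.keys p. (\<Sum>i\<in>UNIV. Poly_Mapping.lookup t i) \<le> d)"

text \<open>
  \<open>(g f)(v) = f(g\<^sup>-\<^sup>1 v)\<close>: the coordinate function \<open>x\<^sub>i\<close> is sent to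
  \<open>v \<mapsto> x\<^sub>i(g\<^sup>-\<^sup>1 v) = \<Sum>\<^sub>j A(g\<^sup>-\<^sup>1)\<^sub>i\<^sub>j x\<^sub>j(v)\<close>.
\<close>

definition poly_act ::
  "('g, 'c) monoid_scheme \<Rightarrow> ('g \<Rightarrow> 'k::field ^ 'n ^ 'n::finite) \<Rightarrow> 'g
     \<Rightarrow> ('n, 'k) mpoly \<Rightarrow> ('n, 'k) mpoly" where
  "poly_act G A g =
     subst (\<lambda>i. \<Sum>j\<in>UNIV. Const (A (inv\<^bsub>G\<^esub> g) $ i $ j) * Var j)"

text \<open>
  The map that \<open>\<phi>\<close> induces on fractions. It is well defined for injective ring homomorphisms, by
  the lemma below.
\<close>

definition fract_map :: "('a::idom \<Rightarrow> 'b::idom) \<Rightarrow> 'a fract \<Rightarrow> 'b fract" where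
  "fract_map \<phi> q = (SOME r. \<exists>a b. b \<noteq> 0 \<and> q = Fract a b \<and> r = Fract (\<phi> a) (\<phi> b))"

lemma fract_map_Fract:
  assumes "\<And>x y. \<phi> (x * y) = \<phi> x * \<phi> y" and "\<phi> 0 = 0" and "inj \<phi>" and "b \<noteq> 0"
  shows "fract_map \<phi> (Fract a b) = Fract (\<phi> a) (\<phi> b)"
proof -
  have nz: "\<phi> x \<noteq> 0" if "x \<noteq> 0" for x
    using assms(2,3) that by (metis injD)
  have eq: "Fract (\<phi> c) (\<phi> d) = Fract (\<phi> a) (\<phi> b)"
    if "d \<noteq> 0" and "Fract a b = Fract c d" for c d
  proof -
    have "a * d = c * b"
      using that \<open>b \<noteq> 0\<close> by (simp add: eq_fract)
    then have "\<phi> a * \<phi> d = \<phi> c * \<phi> b"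
      by (metis assms(1))
    then show ?thesis
      using nz that(1) \<open>b \<noteq> 0\<close> by (simp add: eq_fract)
  qed
  show ?thesis
    unfolding fract_map_def
    using eq \<open>b \<noteq> 0\<close> by (intro some_equality) blast+
qed


subsection \<open>Invariants and the field degree bound\<close>

definition poly_invariants_le ::
  "('g, 'c) monoid_scheme \<Rightarrow> ('g \<Rightarrow> 'k::field ^ 'n ^ 'n::finite) \<Rightarrow> nat \<Rightarrow> ('n, 'k) mpoly set" where
  "poly_invariants_le G A d =
     {p. (\<forall>g\<in>carrier G. poly_act G A g p = p) \<and> total_degree_le d p}"

definition rational_invariants ::
  "('g, 'c) monoid_scheme \<Rightarrow> ('g \<Rightarrow> (('k::field, 'n::{finite,linorder}) vec, 'n) vec)
     \<Rightarrow> ('n, 'k) mpoly fract set" where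
  "rational_invariants G A = {q. \<forall>g\<in>carrier G. fract_map (poly_act G A g) q = q}"

text \<open>The subfield \<open>k(S)\<close> of the fraction field that a set \<open>S\<close> of polynomials generates over \<open>k\<close>.\<close>

definition field_gen :: "('n::{finite,linorder}, 'k::field) mpoly set \<Rightarrow> ('n, 'k) mpoly fract set" where
  "field_gen S = generate_field ring_of_type_algebra ((\<lambda>p. Fract p 1) ` (range Const \<union> S))"

text \<open>
  Such a \<open>d\<close> exists for a finite group: \<open>d = |G|\<close> works, since each \<open>x\<^sub>i\<close> is a root of
  \<open>\<Prod>\<^sub>g (T - g x\<^sub>i)\<close>, whose coefficients are invariants of degree at most \<open>|G|\<close>.
\<close>

definition gamma_field ::
  "('g, 'c) monoid_scheme \<Rightarrow> ('g \<Rightarrow> (('k::field, 'n::{finite,linorder}) vec, 'n) vec) \<Rightarrow> nat" where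
  "gamma_field G A =
     (LEAST d. ring.finite_dimension ring_of_type_algebra
        (field_gen (poly_invariants_le G A d)) (rational_invariants G A))"


subsection \<open>Characters\<close>

text \<open>Characters are taken to be \<open>extensional\<close> so that they can be counted as functions on \<open>G\<close>.\<close>

definition characters :: "('g, 'c) monoid_scheme \<Rightarrow> ('g \<Rightarrow> 'K::field) set" where
  "characters G = hom G (mult_of ring_of_type_algebra) \<inter> extensional (carrier G)"

text \<open>
  For a field embedding \<open>\<iota> : k \<rightarrow> K\<close>, the space \<open>K \<otimes>\<^sub>k V\<close> is \<open>K\<^sup>n\<close> with \<open>g\<close> acting by the matrix
  \<open>A g\<close> read over \<open>K\<close>. The character \<open>\<psi>\<close> occurs in it if it has a nonzero eigenvector.
\<close>

definition occurs_in ::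
  "('g, 'c) monoid_scheme \<Rightarrow> ('k::field \<Rightarrow> 'K::field) \<Rightarrow> ('g \<Rightarrow> 'k ^ 'n ^ 'n::finite)
     \<Rightarrow> ('g \<Rightarrow> 'K) \<Rightarrow> bool" where
  "occurs_in G \<iota> A \<psi> \<longleftrightarrow>
     (\<exists>w::'K ^ 'n. w \<noteq> 0 \<and> (\<forall>g\<in>carrier G. map_matrix \<iota> (A g) *v w = \<psi> g *s w))"

definition nontrivial_characters_in ::
  "('g, 'c) monoid_scheme \<Rightarrow> ('k::field \<Rightarrow> 'K::field) \<Rightarrow> ('g \<Rightarrow> 'k ^ 'n ^ 'n::finite)
     \<Rightarrow> ('g \<Rightarrow> 'K) set" where
  "nontrivial_characters_in G \<iota> A =
     {\<psi> \<in> characters G. occurs_in G \<iota> A \<psi> \<and> \<psi> \<noteq> (\<lambda>g\<in>carrier G. 1)}"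

end

theory Submission
  imports Defs "HOL-Library.Function_Algebras"
begin

text \<open>
  Over \<open>K\<close> the action is diagonal, and a polynomial is invariant iff each of its monomials is.
  If the exponents of the invariant monomials of degree at most \<open>d\<close>, collected by nontrivial
  characters, do not span \<open>\<real>\<^sup>m\<close>, an orthogonal vector defines a grading in which all invariants of
  degree at most \<open>d\<close> have weight 0. The norm of a suitable coordinate function is an invariant of
  positive weight, and for degree reasons it is transcendental over the field generated by
  elements of weight 0. Hence for \<open>d = \<gamma>\<close> these exponents contain a basis of \<open>\<real>\<^sup>m\<close>. The
  nonnegative combinations of that basis, translated by one representative for each of the at least
  \<open>|G|\<close> monomial functions on \<open>G\<close>, are disjoint, and counting lattice points in large simplices
  gives \<open>|G| \<le> d\<^sup>m\<close>.
\<close>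

section \<open>Ring homomorphisms on polynomial rings\<close>

text \<open>All fields of invariants stay over \<open>k\<close>; no invariant field over
  \<open>K\<close> is formed. Only the injective homomorphism \<open>base_change\<close> carries
  polynomials to coordinates dual to a basis of common eigenvectors, and weights are read off there.
  This is why a norm is needed: an eigencoordinate of positive weight need not be defined over
  \<open>k\<close>, but some coordinate function over \<open>k\<close> involves it, and all
  translates of that function have the same monomials over \<open>K\<close>. Coordinates with equal
  characters get equal weights and those with trivial character weight 0, which lowers the rank from
  the dimension of \<open>V\<close> to the number of nontrivial characters. The count of monomial
  functions does without the structure of the dual group: by faithfulness the characters separate
  the points of \<open>G\<close>, and a separating family that contains 1 and is closed under
  products spans all functions. The translates are disjoint because the monomial function of a point
  determines the representative, and linear independence then determines the coefficients.\<close>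

definition is_ring_hom :: "('a::comm_ring_1 \<Rightarrow> 'b::comm_ring_1) \<Rightarrow> bool" where
  "is_ring_hom f \<longleftrightarrow> f 0 = 0 \<and> f 1 = 1 \<and> (\<forall>x y. f (x + y) = f x + f y) \<and> (\<forall>x y. f (x * y) = f x * f y)"

lemma is_ring_hom_simps:
  assumes "is_ring_hom f"
  shows "f 0 = 0" "f 1 = 1" "f (x + y) = f x + f y" "f (x * y) = f x * f y"
  using assms by (auto simp: is_ring_hom_def)

lemma is_ring_hom_sum: "is_ring_hom f \<Longrightarrow> f (sum g A) = (\<Sum>x\<in>A. f (g x))"
  by (induction A rule: infinite_finite_induct) (auto simp: is_ring_hom_simps)

lemma is_ring_hom_prod: "is_ring_hom f \<Longrightarrow> f (prod g A) = (\<Prod>x\<in>A. f (g x))"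
  by (induction A rule: infinite_finite_induct) (auto simp: is_ring_hom_simps)

lemma is_ring_hom_power: "is_ring_hom f \<Longrightarrow> f (x ^ n) = f x ^ n"
  by (induction n) (auto simp: is_ring_hom_simps)

lemma is_ring_hom_uminus:
  assumes "is_ring_hom f" shows "f (- x) = - f x"
proof -
  have "f (- x) + f x = f (- x + x)"
    using assms by (simp only: is_ring_hom_simps)
  also have "\<dots> = 0"
    using assms by (simp add: is_ring_hom_simps)
  finally show ?thesis
    by (simp add: add_eq_0_iff)
qed

lemma is_ring_hom_diff: "is_ring_hom f \<Longrightarrow> f (x - y) = f x - f y"
  by (metis diff_conv_add_uminus is_ring_hom_simps(3) is_ring_hom_uminus)

lemma is_ring_hom_comp:
  "is_ring_hom f \<Longrightarrow> is_ring_hom g \<Longrightarrow> is_ring_hom (\<lambda>x. f (g x))"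
  unfolding is_ring_hom_def by metis

lemma is_ring_hom_id: "is_ring_hom (\<lambda>x. x)"
  by (simp add: is_ring_hom_def)

lemma is_ring_hom_injI:
  assumes "is_ring_hom f" and "\<And>x. f x = 0 \<Longrightarrow> x = 0" shows "inj f"
proof (rule injI)
  fix x y assume "f x = f y"
  then have "f (x - y) = 0" by (simp add: is_ring_hom_diff[OF assms(1)])
  then show "x = y" using assms(2) by force
qed

lemma is_ring_hom_field_inj:
  fixes f :: "'a::field \<Rightarrow> 'b::field"
  assumes "is_ring_hom f" shows "inj f"
proof (rule is_ring_hom_injI[OF assms])
  fix x assume "f x = 0"
  show "x = 0"
  proof (rule ccontr)
    assume "x \<noteq> 0"
    then have "f x * f (inverse x) = 1"
      by (metis assms is_ring_hom_simps(2,4) right_inverse)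
    with \<open>f x = 0\<close> show False by simp
  qed
qed

section \<open>Evaluation homomorphisms on the polynomial ring\<close>

lemma is_ring_hom_Const: "is_ring_hom (Const :: 'k::field \<Rightarrow> ('n, 'k) mpoly)"
  by (auto simp: is_ring_hom_def Const_def single_add mult_single)

lemma mpoly_sum_monomials:
  fixes p :: "('n, 'k::field) mpoly"
  shows "p = (\<Sum>t\<in>Poly_Mapping.keys p. Poly_Mapping.single t (Poly_Mapping.lookup p t))"
proof (rule poly_mapping_eqI)
  fix k
  have "Poly_Mapping.lookup (\<Sum>t\<in>Poly_Mapping.keys p. Poly_Mapping.single t (Poly_Mapping.lookup p t)) k
      = (\<Sum>t\<in>Poly_Mapping.keys p. if t = k then Poly_Mapping.lookup p k else 0)"
    by (auto simp: lookup_sum lookup_single when_def intro!: sum.cong)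
  also have "\<dots> = Poly_Mapping.lookup p k"
    by (simp add: in_keys_iff)
  finally show "Poly_Mapping.lookup p k = Poly_Mapping.lookup
      (\<Sum>t\<in>Poly_Mapping.keys p. Poly_Mapping.single t (Poly_Mapping.lookup p t)) k" by simp
qed

lemma Var_power: "(Var i :: ('n, 'k::field) mpoly) ^ k = Poly_Mapping.single (Poly_Mapping.single i k) 1"
  by (induction k) (auto simp: Var_def mult_single single_add[symmetric])

lemma exponent_sum_single:
  fixes t :: "'n::finite \<Rightarrow>\<^sub>0 nat"
  shows "(\<Sum>i\<in>UNIV. Poly_Mapping.single i (Poly_Mapping.lookup t i)) = t"
  by (rule poly_mapping_eqI) (simp add: lookup_sum lookup_single when_def)

lemma single_eq_Const_Var:
  fixes t :: "'n::finite \<Rightarrow>\<^sub>0 nat"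
  shows "Poly_Mapping.single t (c::'k::field)
    = Const c * (\<Prod>i\<in>UNIV. Var i ^ Poly_Mapping.lookup t i)"
proof -
  have "(\<Prod>i\<in>A. (Var i :: ('n, 'k) mpoly) ^ Poly_Mapping.lookup t i)
      = Poly_Mapping.single (\<Sum>i\<in>A. Poly_Mapping.single i (Poly_Mapping.lookup t i)) 1"
    if "finite A" for A
    using that by induction (auto simp: Var_power mult_single)
  then show ?thesis
    by (simp add: exponent_sum_single Const_def mult_single)
qed

text \<open>The group action, the base change to \<open>K\<close> and diagonal rescalings are all
  instances, so that multiplicativity is proved once. The product over \<open>UNIV\<close> lets
  exponents add without tracking supports.\<close>

definition mpoly_eval ::
  "('k::field \<Rightarrow> 'r::comm_ring_1) \<Rightarrow> ('n::finite \<Rightarrow> 'r) \<Rightarrow> ('n, 'k) mpoly \<Rightarrow> 'r" where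
  "mpoly_eval h \<sigma> p = (\<Sum>t\<in>Poly_Mapping.keys p. h (Poly_Mapping.lookup p t) *
     (\<Prod>i\<in>UNIV. \<sigma> i ^ Poly_Mapping.lookup t i))"

lemma mpoly_eval_superset:
  assumes "h 0 = 0" and "finite S" and "Poly_Mapping.keys p \<subseteq> S"
  shows "mpoly_eval h \<sigma> p = (\<Sum>t\<in>S. h (Poly_Mapping.lookup p t) *
     (\<Prod>i\<in>UNIV. \<sigma> i ^ Poly_Mapping.lookup t i))"
  unfolding mpoly_eval_def using assms
  by (intro sum.mono_neutral_left) (auto simp: in_keys_iff)

lemma mpoly_eval_single:
  assumes "h 0 = 0"
  shows "mpoly_eval h \<sigma> (Poly_Mapping.single t c) = h c * (\<Prod>i\<in>UNIV. \<sigma> i ^ Poly_Mapping.lookup t i)"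
  using assms by (cases "c = 0") (auto simp: mpoly_eval_def)

lemma mpoly_eval_hom:
  fixes \<sigma> :: "'n::finite \<Rightarrow> 'r::comm_ring_1"
  assumes h: "is_ring_hom h"
  shows "is_ring_hom (mpoly_eval h \<sigma>)"
proof -
  note h0 = is_ring_hom_simps(1)[OF h]
  have add: "mpoly_eval h \<sigma> (p + q) = mpoly_eval h \<sigma> p + mpoly_eval h \<sigma> q" for p q
  proof -
    let ?S = "Poly_Mapping.keys p \<union> Poly_Mapping.keys q"
    have "mpoly_eval h \<sigma> (p + q) = (\<Sum>t\<in>?S. h (Poly_Mapping.lookup (p + q) t) *
        (\<Prod>i\<in>UNIV. \<sigma> i ^ Poly_Mapping.lookup t i))"
      by (intro mpoly_eval_superset h0 keys_add) auto
    also have "\<dots> = (\<Sum>t\<in>?S. h (Poly_Mapping.lookup p t) * (\<Prod>i\<in>UNIV. \<sigma> i ^ Poly_Mapping.lookup t i))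
        + (\<Sum>t\<in>?S. h (Poly_Mapping.lookup q t) * (\<Prod>i\<in>UNIV. \<sigma> i ^ Poly_Mapping.lookup t i))"
      by (simp only: lookup_add is_ring_hom_simps(3)[OF h] distrib_right sum.distrib)
    also have "\<dots> = mpoly_eval h \<sigma> p + mpoly_eval h \<sigma> q"
      using mpoly_eval_superset[where h=h and S = ?S and p=p and \<sigma>=\<sigma>, OF h0]
        mpoly_eval_superset[where h=h and S = ?S and p=q and \<sigma>=\<sigma>, OF h0] by simp
    finally show ?thesis .
  qed
  have zero: "mpoly_eval h \<sigma> 0 = 0"
    by (simp add: mpoly_eval_def)
  have sum: "mpoly_eval h \<sigma> (sum f A) = (\<Sum>x\<in>A. mpoly_eval h \<sigma> (f x))" for f and A :: "('n \<Rightarrow>\<^sub>0 nat) set"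
    by (induction A rule: infinite_finite_induct) (auto simp: add zero)
  have mult: "mpoly_eval h \<sigma> (p * q) = mpoly_eval h \<sigma> p * mpoly_eval h \<sigma> q" for p q
  proof -
    have "p * q = (\<Sum>s\<in>Poly_Mapping.keys p. \<Sum>t\<in>Poly_Mapping.keys q.
        Poly_Mapping.single (s + t) (Poly_Mapping.lookup p s * Poly_Mapping.lookup q t))"
      by (subst (1) mpoly_sum_monomials[of p], subst (1) mpoly_sum_monomials[of q])
         (simp add: sum_product mult_single)
    then have "mpoly_eval h \<sigma> (p * q) = (\<Sum>s\<in>Poly_Mapping.keys p. \<Sum>t\<in>Poly_Mapping.keys q.
        h (Poly_Mapping.lookup p s * Poly_Mapping.lookup q t) * (\<Prod>i\<in>UNIV. \<sigma> i ^ Poly_Mapping.lookup (s + t) i))"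
      by (simp add: sum mpoly_eval_single[where h=h, OF h0])
    also have "\<dots> = mpoly_eval h \<sigma> p * mpoly_eval h \<sigma> q"
      unfolding mpoly_eval_def sum_product
      by (intro sum.cong refl)
         (simp add: is_ring_hom_simps[OF h] lookup_add power_add prod.distrib algebra_simps)
    finally show ?thesis .
  qed
  have "mpoly_eval h \<sigma> 1 = 1"
    using mpoly_eval_single[where h=h and \<sigma>=\<sigma> and t=0 and c=1, OF h0] by (simp add: is_ring_hom_simps[OF h])
  then show ?thesis
    by (simp add: is_ring_hom_def add mult zero)
qed

text \<open>Every polynomial is a sum of products of constants and variables. Identities between
  actions and base changes are thereby reduced to matrix computations on the variables.\<close>

lemma mpoly_hom_eqI:
  fixes f g :: "('n::finite, 'k::field) mpoly \<Rightarrow> 'r::comm_ring_1"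
  assumes f: "is_ring_hom f" and g: "is_ring_hom g"
    and C: "\<And>c. f (Const c) = g (Const c)" and V: "\<And>i. f (Var i) = g (Var i)"
  shows "f p = g p"
  by (subst (1 2) mpoly_sum_monomials[of p])
     (simp add: is_ring_hom_sum[OF f] is_ring_hom_sum[OF g] single_eq_Const_Var
       is_ring_hom_simps[OF f] is_ring_hom_simps[OF g] is_ring_hom_prod[OF f]
       is_ring_hom_prod[OF g] is_ring_hom_power[OF f] is_ring_hom_power[OF g] C V)

lemma mpoly_eval_Const: "is_ring_hom h \<Longrightarrow> mpoly_eval h \<sigma> (Const c) = h c"
  by (simp add: Const_def mpoly_eval_single is_ring_hom_simps)

lemma mpoly_eval_Var:
  assumes "is_ring_hom h" shows "mpoly_eval h \<sigma> (Var i) = \<sigma> i"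
proof -
  have "(\<Prod>j\<in>UNIV. \<sigma> j ^ Poly_Mapping.lookup (Poly_Mapping.single i 1) j)
      = (\<Prod>j\<in>UNIV. if j = i then \<sigma> i else 1)"
    by (intro prod.cong) (auto simp: lookup_single when_def)
  then show ?thesis
    using assms by (simp add: Var_def mpoly_eval_single is_ring_hom_simps)
qed

lemma subst_eq_mpoly_eval: "subst \<sigma> = mpoly_eval Const (\<sigma> :: 'n::finite \<Rightarrow> ('n, 'k::field) mpoly)"
proof
  fix p
  have "(\<Prod>i\<in>Poly_Mapping.keys t. \<sigma> i ^ Poly_Mapping.lookup t i)
      = (\<Prod>i\<in>UNIV. \<sigma> i ^ Poly_Mapping.lookup t i)" for t
    by (intro prod.mono_neutral_left) (auto simp: in_keys_iff)
  then show "subst \<sigma> p = mpoly_eval Const \<sigma> p"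
    by (simp add: subst_def mpoly_eval_def)
qed

section \<open>Weights of monomials\<close>

text \<open>The weights are real because they will come from an orthogonal complement in a real
  vector space; they may be negative or zero.\<close>

definition weight :: "('n::finite \<Rightarrow> real) \<Rightarrow> ('n \<Rightarrow>\<^sub>0 nat) \<Rightarrow> real" where
  "weight w t = (\<Sum>i\<in>UNIV. w i * real (Poly_Mapping.lookup t i))"

text \<open>For \<open>p = 0\<close> this is the maximum of the empty set and carries no
  information.\<close>

definition top_weight :: "('n::finite \<Rightarrow> real) \<Rightarrow> ('n, 'k::field) mpoly \<Rightarrow> real" where
  "top_weight w p = Max (weight w ` Poly_Mapping.keys p)"

lemma weight_add: "weight w (s + t) = weight w s + weight w t"
  by (simp add: weight_def lookup_add ring_distribs sum.distrib)

lemma weight_le_top: "t \<in> Poly_Mapping.keys p \<Longrightarrow> weight w t \<le> top_weight w p"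
  by (simp add: top_weight_def)

lemma top_weight_attained:
  assumes "p \<noteq> 0" obtains t where "t \<in> Poly_Mapping.keys p" "weight w t = top_weight w p"
proof -
  have "Poly_Mapping.keys p \<noteq> {}" using assms by simp
  then have "top_weight w p \<in> weight w ` Poly_Mapping.keys p"
    unfolding top_weight_def by (intro Max_in) auto
  then show ?thesis using that by fastforce
qed

lemma top_weight_eqI:
  assumes "t \<in> Poly_Mapping.keys p" "weight w t = a"
    and "\<And>s. s \<in> Poly_Mapping.keys p \<Longrightarrow> weight w s \<le> a"
  shows "top_weight w p = a"
  unfolding top_weight_def using assms by (intro Max_eqI) auto

lemma split_at_weight:
  fixes p :: "('n::finite, 'k::field) mpoly"
  obtains P P' where "p = P + P'"
    "\<And>t. t \<in> Poly_Mapping.keys P \<longleftrightarrow> t \<in> Poly_Mapping.keys p \<and> weight w t = a"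
    "\<And>t. t \<in> Poly_Mapping.keys P' \<longleftrightarrow> t \<in> Poly_Mapping.keys p \<and> weight w t \<noteq> a"
proof -
  define P where "P = Abs_poly_mapping (\<lambda>t. if weight w t = a then Poly_Mapping.lookup p t else 0)"
  define P' where "P' = Abs_poly_mapping (\<lambda>t. if weight w t \<noteq> a then Poly_Mapping.lookup p t else 0)"
  have "finite {t. (if weight w t = a then Poly_Mapping.lookup p t else 0) \<noteq> 0}"
    by (rule finite_subset[OF _ finite_keys[of p]]) (auto simp: in_keys_iff)
  then have P: "Poly_Mapping.lookup P = (\<lambda>t. if weight w t = a then Poly_Mapping.lookup p t else 0)"
    unfolding P_def by (rule lookup_Abs_poly_mapping)
  have "finite {t. (if weight w t \<noteq> a then Poly_Mapping.lookup p t else 0) \<noteq> 0}"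
    by (rule finite_subset[OF _ finite_keys[of p]]) (auto simp: in_keys_iff)
  then have P': "Poly_Mapping.lookup P' = (\<lambda>t. if weight w t \<noteq> a then Poly_Mapping.lookup p t else 0)"
    unfolding P'_def by (rule lookup_Abs_poly_mapping)
  show ?thesis
  proof (rule that)
    show "p = P + P'"
      by (rule poly_mapping_eqI) (simp add: lookup_add P P')
  qed (auto simp: in_keys_iff P P')
qed

text \<open>The product of the top components is nonzero and meets no other monomial of the product.\<close>

lemma top_weight_mult:
  fixes p q :: "('n::{finite,linorder}, 'k::field) mpoly"
  assumes "p \<noteq> 0" "q \<noteq> 0"
  shows "top_weight w (p * q) = top_weight w p + top_weight w q"
proof -
  define a b where "a = top_weight w p" and "b = top_weight w q"
  obtain P P' where P: "p = P + P'"
    "\<And>t. t \<in> Poly_Mapping.keys P \<longleftrightarrow> t \<in> Poly_Mapping.keys p \<and> weight w t = a"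
    "\<And>t. t \<in> Poly_Mapping.keys P' \<longleftrightarrow> t \<in> Poly_Mapping.keys p \<and> weight w t \<noteq> a"
    by (rule split_at_weight[of p w a]) blast
  obtain Q Q' where Q: "q = Q + Q'"
    "\<And>t. t \<in> Poly_Mapping.keys Q \<longleftrightarrow> t \<in> Poly_Mapping.keys q \<and> weight w t = b"
    "\<And>t. t \<in> Poly_Mapping.keys Q' \<longleftrightarrow> t \<in> Poly_Mapping.keys q \<and> weight w t \<noteq> b"
    by (rule split_at_weight[of q w b]) blast
  have "P \<noteq> 0" "Q \<noteq> 0"
    using top_weight_attained[OF assms(1), of w] top_weight_attained[OF assms(2), of w] P(2) Q(2)
    by (metis a_def empty_iff keys_zero, metis b_def empty_iff keys_zero)
  have lt: "weight w t < a" if "t \<in> Poly_Mapping.keys P'" for t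
    using that weight_le_top[of t p w] P(3) unfolding a_def by force
  have lt': "weight w t < b" if "t \<in> Poly_Mapping.keys Q'" for t
    using that weight_le_top[of t q w] Q(3) unfolding b_def by force
  have eq: "weight w t = a + b" if t: "t \<in> Poly_Mapping.keys (P * Q)" for t
  proof -
    obtain x y where "t = x + y" "x \<in> Poly_Mapping.keys P" "y \<in> Poly_Mapping.keys Q"
      using t keys_mult[of P Q] by blast
    then show ?thesis using P(2)[of x] Q(2)[of y] by (simp add: weight_add)
  qed
  have less: "weight w t < a + b" if "t \<in> Poly_Mapping.keys (P * Q' + P' * q)" for t
  proof -
    have "t \<in> Poly_Mapping.keys (P * Q') \<or> t \<in> Poly_Mapping.keys (P' * q)"
      using that keys_add[of "P * Q'" "P' * q"] by blast
    then show ?thesis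
    proof
      assume "t \<in> Poly_Mapping.keys (P * Q')"
      then obtain x y where "t = x + y" "x \<in> Poly_Mapping.keys P" "y \<in> Poly_Mapping.keys Q'"
        using keys_mult[of P Q'] by blast
      then show ?thesis using lt'[of y] P(2)[of x] by (simp add: weight_add)
    next
      assume "t \<in> Poly_Mapping.keys (P' * q)"
      then obtain x y where "t = x + y" "x \<in> Poly_Mapping.keys P'" "y \<in> Poly_Mapping.keys q"
        using keys_mult[of P' q] by blast
      then show ?thesis using lt[of x] weight_le_top[of y q w] by (simp add: weight_add b_def)
    qed
  qed
  have pq: "p * q = P * Q + (P * Q' + P' * q)"
    by (simp add: P(1) Q(1) algebra_simps)
  have "P * Q \<noteq> 0" using \<open>P \<noteq> 0\<close> \<open>Q \<noteq> 0\<close> by simp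
  then obtain t where t: "t \<in> Poly_Mapping.keys (P * Q)"
    by (metis all_not_in_conv keys_eq_empty)
  then have "t \<notin> Poly_Mapping.keys (P * Q' + P' * q)"
    using eq[of t] less[of t] by auto
  then have "t \<in> Poly_Mapping.keys (p * q)"
    using t unfolding pq by (simp add: in_keys_iff lookup_add)
  then show ?thesis
  proof (rule top_weight_eqI)
    show "weight w t = top_weight w p + top_weight w q"
      using eq[OF t] by (simp add: a_def b_def)
    fix s assume "s \<in> Poly_Mapping.keys (p * q)"
    then have "s \<in> Poly_Mapping.keys (P * Q) \<or> s \<in> Poly_Mapping.keys (P * Q' + P' * q)"
      unfolding pq using keys_add[of "P * Q" "P * Q' + P' * q"] by blast
    then show "weight w s \<le> top_weight w p + top_weight w q"
      using eq[of s] less[of s] unfolding a_def b_def by linarith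
  qed
qed

text \<open>A monomial of maximal weight in \<open>p\<close> cannot be cancelled by
  \<open>q\<close>. This will keep the leading term of an algebraic relation alive.\<close>

lemma top_weight_add_less:
  assumes "p \<noteq> 0" "\<And>t. t \<in> Poly_Mapping.keys q \<Longrightarrow> weight w t < top_weight w p"
  shows "p + q \<noteq> 0" and "top_weight w (p + q) = top_weight w p"
proof -
  obtain t where t: "t \<in> Poly_Mapping.keys p" "weight w t = top_weight w p"
    using top_weight_attained[OF assms(1)] .
  then have "t \<notin> Poly_Mapping.keys q" using assms(2) by force
  then have k: "t \<in> Poly_Mapping.keys (p + q)"
    using t(1) by (simp add: in_keys_iff lookup_add)
  then show "p + q \<noteq> 0" by auto
  show "top_weight w (p + q) = top_weight w p"
    using k t(2)
  proof (rule top_weight_eqI)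
    fix s assume "s \<in> Poly_Mapping.keys (p + q)"
    then show "weight w s \<le> top_weight w p"
      using keys_add[of p q] assms(2)[of s] weight_le_top[of s p w] by force
  qed
qed

section \<open>Counting monomials\<close>

text \<open>Lattice points of a simplex of size \<open>s\<close>. The value 0 off \<open>I\<close>
  gives each point exactly one representing function.\<close>

definition bounded_exponents :: "'i set \<Rightarrow> nat \<Rightarrow> ('i \<Rightarrow> nat) set" where
  "bounded_exponents I s = {c. (\<forall>i. i \<notin> I \<longrightarrow> c i = 0) \<and> sum c I \<le> s}"

text \<open>Slice the simplex by the value \<open>k\<close> at the new index: the slice is a simplex
  of size \<open>s - k\<close> in one dimension less, and the hockey-stick identity adds up the
  slices.\<close>

lemma card_bounded_exponents:
  fixes I :: "'i set"
  assumes "finite I"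
  shows "finite (bounded_exponents I s) \<and> card (bounded_exponents I s) = (s + card I) choose card I"
  using assms
proof (induction I arbitrary: s)
  case empty
  have "bounded_exponents ({} :: 'i set) s = {\<lambda>_. 0}"
    by (auto simp: bounded_exponents_def)
  then show ?case by simp
next
  case (insert i I)
  let ?S = "SIGMA k:{..s}. bounded_exponents I (s - k)"
  have upd: "(\<Sum>j\<in>I. if j = i then k else c j) = sum c I" for c k
    using insert(2) by (intro sum.cong) auto
  have bij: "bij_betw (\<lambda>c. (c i, c(i := 0))) (bounded_exponents (insert i I) s) ?S"
  proof (rule bij_betw_byWitness[where f' = "\<lambda>(k, c). c(i := k)"])
    show "\<forall>c\<in>bounded_exponents (insert i I) s. (case (c i, c(i := 0)) of (k, c) \<Rightarrow> c(i := k)) = c"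
      by simp
    show "\<forall>x\<in>?S. (\<lambda>c. (c i, c(i := 0))) (case x of (k, c) \<Rightarrow> c(i := k)) = x"
      using insert(2) by (auto simp: bounded_exponents_def intro!: ext)
    show "(\<lambda>c. (c i, c(i := 0))) ` bounded_exponents (insert i I) s \<subseteq> ?S"
      using insert(1,2) by (auto simp: bounded_exponents_def upd)
    show "(\<lambda>(k, c). c(i := k)) ` ?S \<subseteq> bounded_exponents (insert i I) s"
      using insert(1,2) by (auto simp: bounded_exponents_def upd)
  qed
  have fin: "finite ?S"
    using insert.IH by auto
  have "card ?S = (\<Sum>k\<le>s. (s - k + card I) choose card I)"
    using insert.IH by simp
  also have "\<dots> = (\<Sum>k\<le>s. (card I + k) choose card I)"
    by (rule sum.reindex_bij_witness[of _ "\<lambda>k. s - k" "\<lambda>k. s - k"]) (auto simp: add.commute)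
  also have "\<dots> = (s + card (insert i I)) choose card (insert i I)"
    using insert(1,2) choose_rising_sum(1)[of "card I" s] by (simp add: add.commute)
  finally show ?case
    using bij_betw_finite[OF bij] bij_betw_same_card[OF bij] fin by simp
qed

text \<open>The quotient of the two binomial coefficients is a product of \<open>m\<close> quotients
  of linear functions of \<open>s\<close>, each tending to \<open>d\<close>. The shift
  \<open>R\<close> is lost in the limit.\<close>

lemma binomial_growth_bound:
  fixes N d R m :: nat
  assumes "\<And>s. N * ((s + m) choose m) \<le> (d * s + R + m) choose m"
  shows "N \<le> d ^ m"
proof -
  have frac: "(\<lambda>s. (real d * real s + a) / (real s + b)) \<longlonglongrightarrow> real d" if "b > 0" for a b :: real
  proof -
    have "filterlim (\<lambda>s. real s + b) at_top sequentially"
      by (rule filterlim_at_top_add_at_top filterlim_tendsto_add_at_top filterlim_real_sequentially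
          filterlim_at_top_mono[OF filterlim_real_sequentially])+ (use that in auto)
    then have "(\<lambda>s. real d + (a - real d * b) / (real s + b)) \<longlonglongrightarrow> real d + 0"
      by (intro tendsto_add tendsto_const tendsto_divide_0[OF tendsto_const])
         (rule filterlim_at_top_imp_at_infinity)
    moreover have "real d + (a - real d * b) / (real s + b) = (real d * real s + a) / (real s + b)" for s
      using that by (simp add: field_simps)
    ultimately show ?thesis by simp
  qed
  \<comment> \<open>Since \<open>m - i > 0\<close> for every factor, no denominator vanishes, even
    at \<open>s = 0\<close>.\<close>
  define q where "q s = (\<Prod>i<m. (real d * real s + real (R + m - i)) / (real s + real (m - i)))" for s
  have "q \<longlonglongrightarrow> (\<Prod>i<m. real d)"
    unfolding q_def by (intro tendsto_prod frac) auto
  moreover have "real N \<le> q s" for s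
  proof -
    have c: "real ((n + m) choose m) = (\<Prod>i<m. (real n + real (m - i)) / real (m - i))" for n
      by (subst binomial_altdef_of_nat) (auto simp: of_nat_diff intro!: prod.cong)
    have pos: "real ((s + m) choose m) > 0" by simp
    have "real N * real ((s + m) choose m) \<le> real ((d * s + R + m) choose m)"
      using assms[of s] by (metis of_nat_le_iff of_nat_mult)
    then have "real N \<le> real ((d * s + R + m) choose m) / real ((s + m) choose m)"
      using pos by (simp add: pos_le_divide_eq)
    also have "\<dots> = q s"
      unfolding c q_def prod_dividef[symmetric]
      by (intro prod.cong) (auto simp: of_nat_diff)
    finally show ?thesis .
  qed
  ultimately have "real N \<le> (\<Prod>i<m. real d)"
    by (intro LIMSEQ_le_const) auto
  then have "real N \<le> real (d ^ m)" by simp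
  then show ?thesis by (simp only: of_nat_le_iff)
qed

text \<open>The value 0 off \<open>S\<close> makes equality of functions the same as equality on
  \<open>S\<close>. The exponent 0 gives the indicator function of \<open>S\<close>, which serves as
  the constant 1.\<close>

definition monomial_fun :: "('i \<Rightarrow> 'g \<Rightarrow> 'K::field) \<Rightarrow> 'i set \<Rightarrow> 'g set \<Rightarrow> ('i \<Rightarrow> nat) \<Rightarrow> 'g \<Rightarrow> 'K" where
  "monomial_fun \<psi> J S a = (\<lambda>g. if g \<in> S then \<Prod>i\<in>J. \<psi> i g ^ a i else 0)"

lemma monomial_fun_add:
  "monomial_fun \<psi> J S (\<lambda>i. a i + b i) g = monomial_fun \<psi> J S a g * monomial_fun \<psi> J S b g"
  by (simp add: monomial_fun_def power_add prod.distrib)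

text \<open>A product over \<open>J\<close> of powers can be regrouped by the elements of
  \<open>B\<close>, and each group is a power of 1.\<close>

lemma monomial_fun_combination:
  assumes "\<And>b. b \<in> B \<Longrightarrow> monomial_fun \<psi> J S b = monomial_fun \<psi> J S (\<lambda>_. 0)"
  shows "monomial_fun \<psi> J S (\<lambda>i. \<Sum>b\<in>B. \<gamma> b * b i) = monomial_fun \<psi> J S (\<lambda>_. 0)"
proof
  fix g
  show "monomial_fun \<psi> J S (\<lambda>i. \<Sum>b\<in>B. \<gamma> b * b i) g = monomial_fun \<psi> J S (\<lambda>_. 0) g"
  proof (cases "g \<in> S")
    case True
    have one: "(\<Prod>i\<in>J. \<psi> i g ^ b i) = 1" if "b \<in> B" for b
      using fun_cong[OF assms[OF that], of g] True by (simp add: monomial_fun_def)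
    have "(\<Prod>i\<in>J. \<psi> i g ^ (\<Sum>b\<in>B. \<gamma> b * b i)) = (\<Prod>i\<in>J. \<Prod>b\<in>B. (\<psi> i g ^ b i) ^ \<gamma> b)"
      by (simp add: power_sum power_mult mult.commute)
    also have "\<dots> = (\<Prod>b\<in>B. (\<Prod>i\<in>J. \<psi> i g ^ b i) ^ \<gamma> b)"
      by (subst prod.swap) (simp add: prod_power_distrib)
    also have "\<dots> = 1" using one by simp
    finally show ?thesis using True by (simp add: monomial_fun_def)
  qed (simp add: monomial_fun_def)
qed

text \<open>Translating the nonnegative combinations of \<open>B\<close> by one representative of each monomial
  function packs disjoint copies of a simplex into a simplex that is about \<open>d\<close> times as large.\<close>

lemma card_monomial_funs_le:
  fixes \<psi> :: "'i \<Rightarrow> 'g \<Rightarrow> 'K::field" and B :: "('i \<Rightarrow> nat) set"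
  assumes J: "finite J" and B: "finite B" "card B = card J"
    and supp: "\<And>b i. b \<in> B \<Longrightarrow> i \<notin> J \<Longrightarrow> b i = 0"
    and deg: "\<And>b. b \<in> B \<Longrightarrow> sum b J \<le> d"
    and one: "\<And>b. b \<in> B \<Longrightarrow> monomial_fun \<psi> J S b = monomial_fun \<psi> J S (\<lambda>_. 0)"
    and indep: "\<And>u :: ('i \<Rightarrow> nat) \<Rightarrow> real. (\<And>i. (\<Sum>b\<in>B. u b * real (b i)) = 0) \<Longrightarrow> \<forall>b\<in>B. u b = 0"
    and C: "finite C" "C \<subseteq> monomial_fun \<psi> J S ` {a. \<forall>i. i \<notin> J \<longrightarrow> a i = 0}"
  shows "card C \<le> d ^ card J"
proof -
  have "\<forall>c\<in>C. \<exists>a. (\<forall>i. i \<notin> J \<longrightarrow> a i = 0) \<and> monomial_fun \<psi> J S a = c"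
    using C(2) by blast
  then obtain r where r: "\<And>c i. c \<in> C \<Longrightarrow> i \<notin> J \<Longrightarrow> r c i = 0"
    "\<And>c. c \<in> C \<Longrightarrow> monomial_fun \<psi> J S (r c) = c"
    by metis
  \<comment> \<open>Bounds the degrees of all chosen representatives at once; it only shifts the
    size of the large simplex.\<close>
  define R where "R = (\<Sum>c\<in>C. sum (r c) J)"
  define F where "F = (\<lambda>(c, \<gamma>) i. r c i + (\<Sum>b\<in>B. \<gamma> b * b i))"
  have packing: "card C * ((s + card J) choose card J) \<le> (d * s + R + card J) choose card J" for s
  proof -
    have "inj_on F (C \<times> bounded_exponents B s)"
    proof (rule inj_onI, clarify)
      fix c \<gamma> c' \<gamma>'
      assume c: "c \<in> C" "c' \<in> C" and \<gamma>: "\<gamma> \<in> bounded_exponents B s" "\<gamma>' \<in> bounded_exponents B s"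
        and eq: "F (c, \<gamma>) = F (c', \<gamma>')"
      \<comment> \<open>Adding a combination of \<open>B\<close> leaves the monomial function
        unchanged, so a point of the packing reveals its translate.\<close>
      have cls: "monomial_fun \<psi> J S (F (c, \<gamma>)) = c" if "c \<in> C" for c \<gamma>
      proof
        fix g
        have "monomial_fun \<psi> J S (F (c, \<gamma>)) g
            = monomial_fun \<psi> J S (r c) g * monomial_fun \<psi> J S (\<lambda>_. 0) g"
          unfolding F_def using monomial_fun_combination[OF one, of B \<gamma>] by (simp add: monomial_fun_add)
        also have "\<dots> = monomial_fun \<psi> J S (\<lambda>i. r c i + 0) g"
          by (subst monomial_fun_add) simp
        finally show "monomial_fun \<psi> J S (F (c, \<gamma>)) g = c g"
          using r(2)[OF that] by simp
      qed
      then have "c = c'" using c eq by metis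
      \<comment> \<open>Once the representatives cancel, two equal natural combinations give a real
        linear relation, to which \<open>indep\<close> applies.\<close>
      have "(\<Sum>b\<in>B. (real (\<gamma> b) - real (\<gamma>' b)) * real (b i)) = 0" for i
      proof -
        have "(\<Sum>b\<in>B. \<gamma> b * b i) = (\<Sum>b\<in>B. \<gamma>' b * b i)"
          using fun_cong[OF eq, of i] \<open>c = c'\<close> by (simp add: F_def)
        then have "real (\<Sum>b\<in>B. \<gamma> b * b i) = real (\<Sum>b\<in>B. \<gamma>' b * b i)" by simp
        then show ?thesis by (simp add: ring_distribs sum_subtractf)
      qed
      then have "\<forall>b\<in>B. real (\<gamma> b) - real (\<gamma>' b) = 0" by (rule indep)
      \<comment> \<open>Off \<open>B\<close> both functions are 0 by the definition of
        \<open>bounded_exponents\<close>.\<close>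
      then have "\<gamma> = \<gamma>'"
        using \<gamma> by (auto simp: bounded_exponents_def fun_eq_iff)
      with \<open>c = c'\<close> show "c = c' \<and> \<gamma> = \<gamma>'" by simp
    qed
    moreover have "F ` (C \<times> bounded_exponents B s) \<subseteq> bounded_exponents J (d * s + R)"
    proof (clarify)
      fix c \<gamma> assume c: "c \<in> C" and \<gamma>: "\<gamma> \<in> bounded_exponents B s"
      have "sum (F (c, \<gamma>)) J = sum (r c) J + (\<Sum>b\<in>B. \<gamma> b * sum b J)"
        unfolding F_def by (simp add: sum.distrib sum_distrib_left) (rule sum.swap)
      also have "\<dots> \<le> R + (\<Sum>b\<in>B. \<gamma> b * d)"
        unfolding R_def using C(1) c deg by (intro add_mono member_le_sum sum_mono) auto
      also have "\<dots> \<le> R + s * d"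
        using \<gamma> by (simp add: bounded_exponents_def sum_distrib_right[symmetric])
      finally have "sum (F (c, \<gamma>)) J \<le> d * s + R"
        by (simp add: mult.commute add.commute)
      moreover have "F (c, \<gamma>) i = 0" if "i \<notin> J" for i
        using r(1)[OF c that] supp[OF _ that] by (simp add: F_def sum.neutral)
      ultimately show "F (c, \<gamma>) \<in> bounded_exponents J (d * s + R)"
        by (simp add: bounded_exponents_def)
    qed
    ultimately have "card (C \<times> bounded_exponents B s) \<le> card (bounded_exponents J (d * s + R))"
      using card_bounded_exponents[OF J] by (metis card_inj_on_le)
    then show ?thesis
      using card_bounded_exponents[OF J] card_bounded_exponents[OF B(1)] B(2)
      by (simp add: card_cartesian_product)
  qed
  then show ?thesis by (rule binomial_growth_bound)
qed

section \<open>Linear algebra of functions on a finite set of points\<close>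

interpretation fun_space: vector_space "\<lambda>(c::'K::field) (f::'g \<Rightarrow> 'K) x. c * f x"
  by unfold_locales (auto simp: fun_eq_iff algebra_simps)

text \<open>Multiplication is bilinear, so closure passes from \<open>C\<close> to its span one
  factor at a time. Interpolation below takes products inside the span.\<close>

lemma span_mult_closed:
  fixes C :: "('g \<Rightarrow> 'K::field) set"
  assumes C: "\<And>f h. f \<in> C \<Longrightarrow> h \<in> C \<Longrightarrow> (\<lambda>x. f x * h x) \<in> C"
    and f: "f \<in> fun_space.span C" and h: "h \<in> fun_space.span C"
  shows "(\<lambda>x. f x * h x) \<in> fun_space.span C"
proof -
  have 1: "(\<lambda>x. f x * h x) \<in> fun_space.span C" if "f \<in> fun_space.span C" "h \<in> C" for f h
    using that(1)
  proof (induction rule: fun_space.span_induct_alt)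
    case base
    have "(\<lambda>x. (0 :: 'g \<Rightarrow> 'K) x * h x) = 0" by (simp add: fun_eq_iff)
    then show ?case by (simp only: fun_space.span_zero)
  next
    case (step c u v)
    have "(\<lambda>x. ((\<lambda>x. c * u x) + v) x * h x) = (\<lambda>x. c * (\<lambda>x. u x * h x) x) + (\<lambda>x. v x * h x)"
      by (simp add: fun_eq_iff algebra_simps)
    moreover have "(\<lambda>x. c * (\<lambda>x. u x * h x) x) \<in> fun_space.span C"
      using C[OF step(1) that(2)] by (intro fun_space.span_scale fun_space.span_base)
    ultimately show ?case
      using step(2) by (simp only: fun_space.span_add)
  qed
  show ?thesis
    using h
  proof (induction rule: fun_space.span_induct_alt)
    case base
    have "(\<lambda>x. f x * (0 :: 'g \<Rightarrow> 'K) x) = 0" by (simp add: fun_eq_iff)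
    then show ?case by (simp only: fun_space.span_zero)
  next
    case (step c u v)
    have "(\<lambda>x. f x * ((\<lambda>x. c * u x) + v) x) = (\<lambda>x. c * (\<lambda>x. f x * u x) x) + (\<lambda>x. f x * v x)"
      by (simp add: fun_eq_iff algebra_simps)
    moreover have "(\<lambda>x. c * (\<lambda>x. f x * u x) x) \<in> fun_space.span C"
      using 1[OF f step(1)] by (intro fun_space.span_scale)
    ultimately show ?case
      using step(2) by (simp only: fun_space.span_add)
  qed
qed

text \<open>The monomial functions separate the points of \<open>S\<close>, so they span all functions on \<open>S\<close>.\<close>

lemma many_monomial_funs:
  fixes \<psi> :: "'i \<Rightarrow> 'g \<Rightarrow> 'K::field"
  assumes S: "finite S" and J: "finite J"
    and sep: "\<And>g h. g \<in> S \<Longrightarrow> h \<in> S \<Longrightarrow> g \<noteq> h \<Longrightarrow> \<exists>i\<in>J. \<psi> i g \<noteq> \<psi> i h"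
  shows "\<exists>C. finite C \<and> C \<subseteq> monomial_fun \<psi> J S ` {a. \<forall>i. i \<notin> J \<longrightarrow> a i = 0} \<and> card C = card S"
proof -
  let ?C = "monomial_fun \<psi> J S ` {a. \<forall>i. i \<notin> J \<longrightarrow> a i = 0}"
  have mult: "(\<lambda>x. f x * h x) \<in> ?C" if fh: "f \<in> ?C" "h \<in> ?C" for f h
  proof -
    obtain a b where "f = monomial_fun \<psi> J S a" "h = monomial_fun \<psi> J S b"
      and ab: "\<forall>i. i \<notin> J \<longrightarrow> a i = 0" "\<forall>i. i \<notin> J \<longrightarrow> b i = 0"
      using fh by blast
    then have "(\<lambda>x. f x * h x) = monomial_fun \<psi> J S (\<lambda>i. a i + b i)"
      by (simp add: monomial_fun_add fun_eq_iff)
    with ab show ?thesis by auto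
  qed
  define one where "one = monomial_fun \<psi> J S (\<lambda>_. 0)"
  have one: "one \<in> ?C" "\<And>g. one g = (if g \<in> S then 1 else 0)"
    by (auto simp: one_def monomial_fun_def)
  define gen where "gen i = monomial_fun \<psi> J S (\<lambda>j. if j = i then 1 else 0)" for i
  have gen: "gen i \<in> ?C" "g \<in> S \<Longrightarrow> gen i g = \<psi> i g" if "i \<in> J" for i g
  proof -
    show "gen i \<in> ?C" unfolding gen_def using that by auto
    assume "g \<in> S"
    have "(\<Prod>j\<in>J. \<psi> j g ^ (if j = i then 1 else 0)) = (\<Prod>j\<in>J. if j = i then \<psi> j g else 1)"
      by (intro prod.cong) auto
    then show "gen i g = \<psi> i g"
      using \<open>g \<in> S\<close> that J by (simp add: gen_def monomial_fun_def)
  qed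
  \<comment> \<open>Lagrange interpolation within the span: each further point of \<open>H\<close>
    costs one further factor.\<close>
  have "\<exists>f\<in>fun_space.span ?C. f g = 1 \<and> (\<forall>h\<in>H. f h = 0)"
    if "finite H" "H \<subseteq> S - {g}" "g \<in> S" for g H
    using that
  proof (induction H)
    case empty
    then show ?case using one(2) by (intro bexI[of _ one] fun_space.span_base one(1)) auto
  next
    case (insert h H)
    then obtain f where f: "f \<in> fun_space.span ?C" "f g = 1" "\<forall>h\<in>H. f h = 0" by auto
    obtain i where i: "i \<in> J" "\<psi> i g \<noteq> \<psi> i h" using sep[of g h] insert by auto
    \<comment> \<open>The factor (\<open>gen i\<close> - \<open>\<psi> i h\<close>) /
      (\<open>\<psi> i g\<close> - \<open>\<psi> i h\<close>), the constant being represented by a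
      multiple of \<open>one\<close>.\<close>
    define e where "e = (\<lambda>x. inverse (\<psi> i g - \<psi> i h) * (gen i - (\<lambda>x. \<psi> i h * one x)) x)"
    have "e \<in> fun_space.span ?C"
      unfolding e_def
      by (intro fun_space.span_scale fun_space.span_diff fun_space.span_base gen one i)
    moreover have "e g = 1" "e h = 0"
      using i insert gen(2)[OF i(1)] by (auto simp: e_def one(2))
    ultimately show ?case
      using f by (intro bexI[of _ "\<lambda>x. f x * e x"] span_mult_closed mult) auto
  qed
  then have "\<forall>g\<in>S. \<exists>f\<in>fun_space.span ?C. f g = 1 \<and> (\<forall>h\<in>S - {g}. f h = 0)"
    using S by auto
  then have "\<exists>\<delta>. \<forall>g\<in>S. \<delta> g \<in> fun_space.span ?C \<and> \<delta> g g = 1 \<and> (\<forall>h\<in>S - {g}. \<delta> g h = 0)"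
    by (intro bchoice) blast
  then obtain \<delta> where "\<forall>g\<in>S. \<delta> g \<in> fun_space.span ?C \<and> \<delta> g g = 1 \<and> (\<forall>h\<in>S - {g}. \<delta> g h = 0)"
    by (rule exE)
  then have \<delta>: "\<And>g. g \<in> S \<Longrightarrow> \<delta> g \<in> fun_space.span ?C"
    "\<And>g h. g \<in> S \<Longrightarrow> h \<in> S \<Longrightarrow> \<delta> g h = (if h = g then 1 else 0)"
    by auto
  have inj: "inj_on \<delta> S"
  proof (rule inj_onI)
    fix g h assume "g \<in> S" "h \<in> S" "\<delta> g = \<delta> h"
    then show "g = h" using \<delta>(2)[of g g] \<delta>(2)[of h g] by (auto split: if_splits)
  qed
  have "fun_space.independent (\<delta> ` S)"
  proof (rule fun_space.independent_if_scalars_zero)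
    show "finite (\<delta> ` S)" using S by simp
    fix u f assume u: "(\<Sum>x\<in>\<delta> ` S. (\<lambda>y. u x * x y)) = 0" and "f \<in> \<delta> ` S"
    then obtain g where g: "g \<in> S" "f = \<delta> g" by blast
    have "(\<Sum>h\<in>S. (\<lambda>y. u (\<delta> h) * \<delta> h y)) = 0"
      using u inj by (simp add: sum.reindex)
    then have "(\<Sum>h\<in>S. (\<lambda>y. u (\<delta> h) * \<delta> h y)) g = 0" by simp
    moreover have "(\<Sum>h\<in>T. (\<lambda>y. u (\<delta> h) * \<delta> h y)) g = (\<Sum>h\<in>T. u (\<delta> h) * \<delta> h g)" for T
      by (induction T rule: infinite_finite_induct) auto
    ultimately have "(\<Sum>h\<in>S. u (\<delta> h) * \<delta> h g) = 0" by simp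
    also have "(\<Sum>h\<in>S. u (\<delta> h) * \<delta> h g) = (\<Sum>h\<in>S. if h = g then u (\<delta> g) else 0)"
      using g \<delta>(2) by (intro sum.cong) auto
    finally show "u f = 0" using g S by simp
  qed
  \<comment> \<open>The span contains \<open>card S\<close> independent functions, so a finite
    generating set has at least that many elements.\<close>
  then have le: "card S \<le> card ?C" if "finite ?C"
    using fun_space.independent_span_bound[OF that, of "\<delta> ` S"] \<delta>(1) inj by (auto simp: card_image)
  show ?thesis
  \<comment> \<open>The values of \<open>\<psi>\<close> are arbitrary field elements here, so there
    may be infinitely many monomial functions; any \<open>card S\<close> of them then serve.\<close>
  proof (cases "finite ?C")
    case True
    obtain C where "C \<subseteq> ?C" "card C = card S" "finite C"
      by (rule obtain_subset_with_card_n[OF le[OF True]])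
    then show ?thesis by blast
  next
    case False
    then show ?thesis using infinite_arbitrarily_large[OF False, of "card S"] by blast
  qed
qed

section \<open>A weight vector orthogonal to the invariant monomials of small degree\<close>

definition exponent_vector :: "('n::finite \<Rightarrow> nat) \<Rightarrow> real ^ 'n" where
  "exponent_vector a = (\<chi> i. real (a i))"

lemma inj_exponent_vector: "inj exponent_vector"
  by (rule injI) (simp add: exponent_vector_def vec_eq_iff fun_eq_iff)

text \<open>The packing bound read backwards: exponents of full rank \<open>card J\<close> would
  contain a basis and force \<open>card S \<le> d ^ card J\<close>. So they span a proper subspace,
  and its orthogonal complement inside the coordinate subspace of \<open>J\<close> supplies the
  weights.\<close>

lemma exists_orthogonal_weight:
  fixes \<psi> :: "'n::finite \<Rightarrow> 'g \<Rightarrow> 'K::field"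
  assumes S: "finite S"
    and sep: "\<And>g h. g \<in> S \<Longrightarrow> h \<in> S \<Longrightarrow> g \<noteq> h \<Longrightarrow> \<exists>i\<in>J. \<psi> i g \<noteq> \<psi> i h"
    and less: "d ^ card J < card S"
  shows "\<exists>w :: 'n \<Rightarrow> real. (\<exists>i\<in>J. w i > 0) \<and>
    (\<forall>a. (\<forall>i. i \<notin> J \<longrightarrow> a i = 0) \<longrightarrow> sum a J \<le> d \<longrightarrow> (\<forall>g\<in>S. (\<Prod>i\<in>J. \<psi> i g ^ a i) = 1)
      \<longrightarrow> (\<Sum>i\<in>J. w i * real (a i)) = 0)"
proof -
  define A where "A = {a. (\<forall>i. i \<notin> J \<longrightarrow> a i = 0) \<and> sum a J \<le> d \<and> (\<forall>g\<in>S. (\<Prod>i\<in>J. \<psi> i g ^ a i) = 1)}"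
  define E where "E = exponent_vector ` A"
  define V where "V = {x :: real ^ 'n. \<forall>i. i \<notin> J \<longrightarrow> x $ i = 0}"
  have dimV: "dim V = card J"
    using dim_substandard_cart[where 'a = real, of J]
    by (simp add: V_def dim_vec_eq)
  have subV: "subspace V"
    by (auto simp: V_def subspace_def)
  have EV: "E \<subseteq> V"
    by (auto simp: E_def A_def V_def exponent_vector_def)
  have "dim E \<noteq> card J"
  proof
    assume dimE: "dim E = card J"
    obtain E' where E': "E' \<subseteq> E" "independent E'" "card E' = dim E"
      by (rule basis_exists)
    have finE': "finite E'" using E'(2) independent_imp_finite by blast
    \<comment> \<open>The basis is pulled back to natural exponents, which are what the packing
      bound speaks of.\<close>
    define B where "B = {a \<in> A. exponent_vector a \<in> E'}"
    have BE: "exponent_vector ` B = E'"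
      using E'(1) by (auto simp: B_def E_def)
    have inj: "inj_on exponent_vector B"
      using inj_exponent_vector inj_on_subset by blast
    have finB: "finite B"
      using BE finE' inj finite_image_iff by metis
    have cardB: "card B = card J"
      using BE inj E'(3) dimE card_image by metis
    have "\<exists>C. finite C \<and> C \<subseteq> monomial_fun \<psi> J S ` {a. \<forall>i. i \<notin> J \<longrightarrow> a i = 0} \<and> card C = card S"
      by (rule many_monomial_funs[OF S finite sep])
    then obtain C where C: "finite C" "C \<subseteq> monomial_fun \<psi> J S ` {a. \<forall>i. i \<notin> J \<longrightarrow> a i = 0}" "card C = card S"
      by blast
    have "card C \<le> d ^ card J"
    proof (rule card_monomial_funs_le[OF _ finB cardB _ _ _ _ C(1,2)])
      fix u :: "('n \<Rightarrow> nat) \<Rightarrow> real" assume u: "\<And>i. (\<Sum>b\<in>B. u b * real (b i)) = 0"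
      let ?inv = "inv_into B exponent_vector"
      have "(\<Sum>v\<in>E'. u (?inv v) *\<^sub>R v) = (\<Sum>b\<in>B. u b *\<^sub>R exponent_vector b)"
        unfolding BE[symmetric] using inj by (simp add: sum.reindex)
      also have "\<dots> = 0"
        using u by (simp add: vec_eq_iff exponent_vector_def)
      finally have "(\<Sum>v\<in>E'. u (?inv v) *\<^sub>R v) = 0" .
      then have *: "\<forall>v\<in>E'. u (?inv v) = 0"
        by (intro ballI independentD[OF E'(2) finE', where u = "\<lambda>v. u (?inv v)"]) auto
      show "\<forall>b\<in>B. u b = 0"
      proof
        fix b assume "b \<in> B"
        then show "u b = 0" using * BE inj by (metis image_eqI inv_into_f_f)
      qed
    qed (auto simp: B_def A_def monomial_fun_def fun_eq_iff)
    with C(3) less show False by simp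
  qed
  moreover have "span E \<subseteq> V"
    using EV subV by (rule span_minimal)
  moreover have "dim (span E) = dim E" by simp
  ultimately have "span E \<noteq> V" using dimV by metis
  then have "span E \<subset> span V"
    using \<open>span E \<subseteq> V\<close> subV by (metis psubsetI span_eq_iff)
  then obtain x where x: "x \<noteq> 0" "x \<in> span V" "\<And>y. y \<in> span E \<Longrightarrow> orthogonal x y"
    using orthogonal_to_subspace_exists_gen by blast
  have xV: "x $ i = 0" if "i \<notin> J" for i
    using x(2) subV that by (auto simp: V_def span_eq_iff[THEN iffD2])
  have orth: "(\<Sum>i\<in>J. x $ i * real (a i)) = 0" if "a \<in> A" for a
  proof -
    have "orthogonal x (exponent_vector a)"
      using x(3) that by (auto simp: E_def span_base)
    then have "(\<Sum>i\<in>UNIV. x $ i * real (a i)) = 0"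
      by (simp add: orthogonal_def inner_vec_def exponent_vector_def)
    moreover have "(\<Sum>i\<in>UNIV. x $ i * real (a i)) = (\<Sum>i\<in>J. x $ i * real (a i))"
      using xV by (intro sum.mono_neutral_right) auto
    ultimately show ?thesis by simp
  qed
  obtain i where i: "x $ i \<noteq> 0" using x(1) by (auto simp: vec_eq_iff)
  then have "i \<in> J" using xV by blast
  \<comment> \<open>Passing to the negative vector if necessary makes the entry at \<open>i\<close>
    positive and keeps orthogonality.\<close>
  define w where "w j = sgn (x $ i) * x $ j" for j
  show ?thesis
  proof (intro exI[of _ w] conjI bexI[of _ i] allI impI)
    show "w i > 0" using i by (simp add: w_def sgn_real_def)
    show "i \<in> J" by fact
    fix a assume "\<forall>i. i \<notin> J \<longrightarrow> a i = 0" "sum a J \<le> d" "\<forall>g\<in>S. (\<Prod>i\<in>J. \<psi> i g ^ a i) = 1"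
    then have "(\<Sum>i\<in>J. x $ i * real (a i)) = 0"
      by (intro orth) (auto simp: A_def)
    then show "(\<Sum>i\<in>J. w i * real (a i)) = 0"
      by (simp add: w_def mult.assoc sum_distrib_left[symmetric])
  qed
qed

section \<open>Simultaneous diagonalisation\<close>

text \<open>Multiplication by a root \<open>w\<close> with \<open>w ^ k \<noteq> 1\<close> permutes
  the roots and scales the sum by \<open>w ^ k\<close>. Such a \<open>w\<close> exists because X^k -
  1 has at most \<open>k\<close> roots, fewer than the \<open>N\<close> roots of unity in
  \<open>K\<close>.\<close>

lemma sum_roots_of_unity_power:
  fixes N k :: nat
  assumes N: "card {z::'K::field. z ^ N = 1} = N" and k: "0 < k" "k < N"
  shows "(\<Sum>z | z ^ N = 1. (z::'K) ^ k) = 0"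
proof -
  let ?Z = "{z::'K. z ^ N = 1}"
  let ?p = "Polynomial.monom 1 k - 1 :: 'K poly"
  have coeff: "poly.coeff ?p k = 1" using k by simp
  then have "?p \<noteq> 0" by (metis coeff_0 zero_neq_one)
  then have "finite {z. poly ?p z = 0}" "card {z. poly ?p z = 0} \<le> Polynomial.degree ?p"
    using poly_roots_finite card_poly_roots_bound by blast+
  moreover have "Polynomial.degree ?p \<le> k"
    by (intro degree_diff_le) (auto simp: degree_monom_le)
  moreover have "{z. poly ?p z = 0} = {z. z ^ k = 1}"
    by (auto simp: poly_monom)
  ultimately have "\<not> ?Z \<subseteq> {z. z ^ k = 1}"
    using N k card_mono[of "{z::'K. z ^ k = 1}" ?Z] by auto
  then obtain w :: 'K where w: "w ^ N = 1" "w ^ k \<noteq> 1" by blast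
  have "w \<noteq> 0" using w(1) k by (auto simp: zero_power)
  have "(\<Sum>z\<in>?Z. z ^ k) = (\<Sum>z\<in>?Z. (w * z) ^ k)"
    by (rule sum.reindex_bij_witness[of _ "\<lambda>z. w * z" "\<lambda>z. z / w"])
       (use w \<open>w \<noteq> 0\<close> in \<open>auto simp: power_mult_distrib power_divide\<close>)
  also have "\<dots> = w ^ k * (\<Sum>z\<in>?Z. z ^ k)"
    by (simp add: power_mult_distrib sum_distrib_left)
  finally have "(w ^ k - 1) * (\<Sum>z\<in>?Z. z ^ k) = 0"
    by (simp add: algebra_simps)
  then show ?thesis using w(2) by simp
qed

lemma matrix_vector_scale_sum:
  fixes M :: "'K::field ^ 'n ^ 'n::finite"
  shows "M *v (\<Sum>k\<in>I. c k *s v k) = (\<Sum>k\<in>I. c k *s (M *v v k))"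
  by (induction I rule: infinite_finite_induct)
     (auto simp: matrix_vector_right_distrib vec.scale)

text \<open>The eigencomponents of \<open>v\<close> are its discrete Fourier transforms along the orbit of \<open>M\<close>;
  they inherit every eigenvector relation from \<open>v\<close> for matrices that commute with \<open>M\<close>.\<close>

lemma eigenvector_decomposition:
  fixes M :: "'K::field ^ 'n ^ 'n::finite" and v :: "'K ^ 'n"
  assumes N: "card {z::'K. z ^ N = 1} = N" "(of_nat N :: 'K) \<noteq> 0"
    and M: "((*v) M ^^ N) v = v"
  shows "v \<in> vec.span {u. (\<exists>c. M *v u = c *s u) \<and>
    (\<forall>H c. H ** M = M ** H \<longrightarrow> H *v v = c *s v \<longrightarrow> H *v u = c *s u)}" (is "v \<in> vec.span ?E")
proof -
  let ?Z = "{z::'K. z ^ N = 1}"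
  have "N > 0" using N(2) by (cases N) auto
  define f where "f k = ((*v) M ^^ k) v" for k
  have f: "f 0 = v" "f (Suc k) = M *v f k" "f N = v" for k
    using M by (simp_all add: f_def)
  \<comment> \<open>The component of \<open>v\<close> for the eigenvalue \<open>inverse z\<close>,
    up to the factor \<open>N\<close> that is divided out at the end.\<close>
  define pr where "pr z = (\<Sum>k<N. z ^ k *s f k)" for z
  have "pr z \<in> ?E" if z: "z \<in> ?Z" for z
  proof -
    have "z \<noteq> 0" using z \<open>N > 0\<close> by (auto simp: zero_power)
    \<comment> \<open>Applying \<open>z\<close> times \<open>M\<close> shifts the summation index,
      and the sum closes up because \<open>z ^ N = 1\<close> and \<open>f N = v\<close>.\<close>
    have "z *s (M *v pr z) = (\<Sum>k<N. z ^ Suc k *s f (Suc k))"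
      unfolding pr_def matrix_vector_scale_sum by (simp add: vec.scale_sum_right f(2))
    also have "\<dots> = pr z"
    proof -
      have "(\<Sum>k<Suc N. z ^ k *s f k) = pr z + v"
        using z by (simp add: pr_def f(3))
      moreover have "(\<Sum>k<Suc N. z ^ k *s f k) = v + (\<Sum>k<N. z ^ Suc k *s f (Suc k))"
        by (subst sum.lessThan_Suc_shift) (simp add: f(1))
      ultimately show ?thesis by (metis add.commute add_left_cancel)
    qed
    finally have "M *v pr z = inverse z *s pr z"
      using \<open>z \<noteq> 0\<close> by (metis left_inverse vec.scale_one vector_smult_assoc)
    moreover have "H *v pr z = c *s pr z" if H: "H ** M = M ** H" "H *v v = c *s v" for H c
    proof -
      have "H *v f k = c *s f k" for k
      proof (induction k)
        case (Suc k)
        have "H *v f (Suc k) = M *v (H *v f k)"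
          by (simp add: f(2) matrix_vector_mul_assoc H(1))
        then show ?case using Suc by (simp add: f(2) vec.scale)
      qed (simp add: f(1) H(2))
      then show ?thesis
        unfolding pr_def matrix_vector_scale_sum
        by (simp add: vec.scale_sum_right vector_smult_assoc mult.commute)
    qed
    ultimately show ?thesis by blast
  qed
  then have "(\<Sum>z\<in>?Z. inverse (of_nat N) *s pr z) \<in> vec.span ?E"
    by (intro vec.span_sum vec.span_scale vec.span_base)
  moreover have "(\<Sum>z\<in>?Z. inverse (of_nat N) *s pr z) = v"
  proof -
    \<comment> \<open>Orthogonality of the roots of unity removes every term except
      \<open>k = 0\<close>.\<close>
    have "(\<Sum>z\<in>?Z. pr z) = (\<Sum>k<N. (\<Sum>z\<in>?Z. z ^ k) *s f k)"
      unfolding pr_def by (subst sum.swap) (simp add: vec.scale_sum_left)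
    also have "\<dots> = (\<Sum>k<N. if k = 0 then of_nat N *s v else 0)"
      using N(1) by (intro sum.cong) (auto simp: sum_roots_of_unity_power f(1))
    also have "\<dots> = of_nat N *s v" using \<open>N > 0\<close> by simp
    finally show ?thesis
      using N(2) by (simp add: vec.scale_sum_right[symmetric] vector_smult_assoc)
  qed
  ultimately show ?thesis by simp
qed

text \<open>Group elements are added one at a time: a common eigenvector for \<open>S\<close> splits
  into eigenvectors for \<open>g\<close>, and these remain eigenvectors for \<open>S\<close> since
  the matrices commute. A basis selected from the resulting spanning set forms the columns of
  \<open>P\<close>.\<close>

lemma common_eigenbasis:
  fixes A :: "'g \<Rightarrow> 'K::field ^ 'n ^ 'n::finite"
  assumes G: "comm_group G" "finite (carrier G)"
    and N: "card {z::'K. z ^ card (carrier G) = 1} = card (carrier G)"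
      "(of_nat (card (carrier G)) :: 'K) \<noteq> 0"
    and mult: "\<And>g h. g \<in> carrier G \<Longrightarrow> h \<in> carrier G \<Longrightarrow> A (g \<otimes>\<^bsub>G\<^esub> h) = A g ** A h"
    and one: "A \<one>\<^bsub>G\<^esub> = mat 1"
  obtains P :: "'K ^ 'n ^ 'n" and \<psi> where "invertible P"
    "\<And>g i. g \<in> carrier G \<Longrightarrow> A g *v column i P = \<psi> i g *s column i P"
proof -
  interpret comm_group G by fact
  have pow: "((*v) (A g) ^^ k) v = A (g [^]\<^bsub>G\<^esub> k) *v v" if g: "g \<in> carrier G" for g k v
  proof (induction k)
    case (Suc k)
    then show ?case
      using g by (simp add: matrix_vector_mul_assoc mult[symmetric] m_comm)
  qed (simp add: one)
  have "vec.span {v. \<forall>g\<in>S. \<exists>c. A g *v v = c *s v} = UNIV" if "finite S" "S \<subseteq> carrier G" for S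
    using that
  proof (induction S)
    case empty
    then show ?case by (simp add: vec.span_UNIV)
  next
    case (insert g S)
    let ?E = "{v. \<forall>g\<in>S. \<exists>c. A g *v v = c *s v}" and ?E' = "{v. \<forall>g\<in>insert g S. \<exists>c. A g *v v = c *s v}"
    have "v \<in> vec.span ?E'" if v: "v \<in> ?E" for v
    proof -
      have g: "g \<in> carrier G" using insert by simp
      \<comment> \<open>The order of \<open>G\<close> annihilates \<open>g\<close>; this is the
        periodicity that the Fourier decomposition requires.\<close>
      have "((*v) (A g) ^^ card (carrier G)) v = v"
        using pow[OF g] pow_order_eq_1[OF g] by (simp add: one order_def)
      from eigenvector_decomposition[OF N this]
      show ?thesis
      proof (rule set_mp[OF vec.span_mono, rotated], intro subsetI CollectI ballI)
        fix u h assume u: "u \<in> {u. (\<exists>c. A g *v u = c *s u) \<and>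
            (\<forall>H c. H ** A g = A g ** H \<longrightarrow> H *v v = c *s v \<longrightarrow> H *v u = c *s u)}"
          and h: "h \<in> insert g S"
        show "\<exists>c. A h *v u = c *s u"
        proof (cases "h = g")
          case True
          then show ?thesis using u by blast
        next
          case False
          then have "h \<in> S" using h by simp
          then have "A h ** A g = A g ** A h"
            using insert g by (subst (1 2) mult[symmetric]) (auto simp: m_comm)
          then show ?thesis using u v \<open>h \<in> S\<close> by blast
        qed
      qed
    qed
    then have "vec.span ?E \<subseteq> vec.span ?E'"
      by (intro vec.span_minimal) (auto simp: vec.subspace_span)
    then show ?case using insert by auto
  qed
  then have span: "vec.span {v. \<forall>g\<in>carrier G. \<exists>c. A g *v v = c *s v} = UNIV" (is "vec.span ?E = _")
    using G(2) by blast
  obtain B where B: "B \<subseteq> ?E" "vec.independent B" "?E \<subseteq> vec.span B"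
    using vec.maximal_independent_subset by blast
  have spanB: "vec.span B = UNIV"
    using B(3) span vec.span_minimal vec.subspace_span by blast
  then have "card B = CARD('n)"
    using B(2) vec.dim_eq_card[of B UNIV] vec_dim_card by (metis vec.span_UNIV)
  moreover have "finite B" using B(2) vec.finiteI_independent by blast
  ultimately obtain e :: "'n \<Rightarrow> 'K ^ 'n" where e: "bij_betw e UNIV B"
    using finite_same_card_bij[of "UNIV :: 'n set" B] by auto
  define P where "P = (\<chi> i j. e j $ i)"
  have col: "column j P = e j" for j
    by (simp add: P_def column_def vec_eq_iff)
  have "columns P = B"
    using e by (auto simp: columns_def col bij_betw_def)
  then have "invertible P"
    using spanB matrix_right_invertible_span_columns[of P] by (simp add: invertible_right_inverse)
  moreover have "\<forall>i g. \<exists>c. g \<in> carrier G \<longrightarrow> A g *v column i P = c *s column i P"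
    using B(1) e by (auto simp: col bij_betw_def)
  then obtain \<psi> where "\<And>i g. g \<in> carrier G \<Longrightarrow> A g *v column i P = \<psi> i g *s column i P"
    by metis
  ultimately show ?thesis using that by blast
qed

section \<open>The library ring on a type\<close>

lemma ring_of_type_algebra_simps [simp]:
  "carrier (ring_of_type_algebra :: 'a::comm_ring_1 ring) = UNIV"
  "x \<otimes>\<^bsub>ring_of_type_algebra\<^esub> y = (x * y :: 'a)"
  "x \<oplus>\<^bsub>ring_of_type_algebra\<^esub> y = (x + y :: 'a)"
  "\<one>\<^bsub>ring_of_type_algebra\<^esub> = (1 :: 'a)"
  "\<zero>\<^bsub>ring_of_type_algebra\<^esub> = (0 :: 'a)"
  by (simp_all add: ring_of_type_algebra_def)

lemma ring_of_type_algebra_a_inv [simp]: "\<ominus>\<^bsub>ring_of_type_algebra\<^esub> x = (- x :: 'a::comm_ring_1)"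
proof -
  interpret ring "ring_of_type_algebra :: 'a ring" by (rule ring_from_type_algebra)
  show ?thesis by (rule minus_equality) auto
qed

lemma ring_of_type_algebra_m_inv:
  assumes "x \<noteq> (0 :: 'a::field)"
  shows "inv\<^bsub>ring_of_type_algebra\<^esub> x = inverse x"
proof -
  interpret cring "ring_of_type_algebra :: 'a ring" by (rule cring_from_type_algebra)
  show ?thesis using assms by (intro comm_inv_char) auto
qed

lemma ring_of_type_algebra_pow [simp]: "x [^]\<^bsub>ring_of_type_algebra\<^esub> (n::nat) = (x ^ n :: 'a::comm_ring_1)"
proof -
  interpret ring "ring_of_type_algebra :: 'a ring" by (rule ring_from_type_algebra)
  show ?thesis by (induction n) (auto simp: mult.commute)
qed

text \<open>Polynomials in HOL-Algebra are coefficient lists with the leading coefficient first,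
  hence the reversal.\<close>

lemma ring_of_type_algebra_eval:
  "ring.eval ring_of_type_algebra (map c (rev [0..<n])) (x :: 'a::comm_ring_1) = (\<Sum>k<n. c k * x ^ k)"
proof -
  interpret ring "ring_of_type_algebra :: 'a ring" by (rule ring_from_type_algebra)
  show ?thesis by (induction n) (auto simp: add.commute)
qed

lemma is_ring_hom_Fract: "is_ring_hom (\<lambda>p. Fract p 1 :: 'a::idom fract)"
  by (simp add: is_ring_hom_def Zero_fract_def One_fract_def)

section \<open>Degrees\<close>

lemma total_degree_le_mono: "total_degree_le d p \<Longrightarrow> d \<le> e \<Longrightarrow> total_degree_le e p"
  unfolding total_degree_le_def by (meson le_trans)

lemma total_degree_le_0: "total_degree_le d 0"
  by (simp add: total_degree_le_def)

lemma total_degree_le_1: "total_degree_le d 1"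
  by (simp add: total_degree_le_def)

lemma total_degree_le_add: "total_degree_le d p \<Longrightarrow> total_degree_le d q \<Longrightarrow> total_degree_le d (p + q)"
  using keys_add[of p q] unfolding total_degree_le_def by blast

lemma total_degree_le_uminus: "total_degree_le d p \<Longrightarrow> total_degree_le d (- p)"
  by (simp add: total_degree_le_def in_keys_iff)

lemma total_degree_le_sum:
  "(\<And>x. x \<in> A \<Longrightarrow> total_degree_le d (f x)) \<Longrightarrow> total_degree_le d (sum f A)"
  by (induction A rule: infinite_finite_induct) (auto simp: total_degree_le_0 total_degree_le_add)

lemma total_degree_le_mult:
  assumes "total_degree_le d p" "total_degree_le e q"
  shows "total_degree_le (d + e) (p * q)"
  unfolding total_degree_le_def
proof
  fix t assume "t \<in> Poly_Mapping.keys (p * q)"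
  then obtain x y where "t = x + y" "x \<in> Poly_Mapping.keys p" "y \<in> Poly_Mapping.keys q"
    using keys_mult[of p q] by blast
  then show "(\<Sum>i\<in>UNIV. Poly_Mapping.lookup t i) \<le> d + e"
    using assms by (auto simp: total_degree_le_def lookup_add sum.distrib intro!: add_mono)
qed

lemma total_degree_le_power: "total_degree_le 1 p \<Longrightarrow> total_degree_le n (p ^ n)"
  using total_degree_le_mult[of 1 p] by (induction n) (auto simp: total_degree_le_1)

lemma total_degree_le_prod:
  "(\<And>x. x \<in> A \<Longrightarrow> total_degree_le (e x) (f x)) \<Longrightarrow> total_degree_le (sum e A) (prod f A)"
  by (induction A rule: infinite_finite_induct) (auto simp: total_degree_le_1 total_degree_le_mult)

lemma total_degree_le_Const: "total_degree_le d (Const c)"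
  by (simp add: total_degree_le_def Const_def)

lemma total_degree_le_Var: "total_degree_le 1 (Var i)"
  by (simp add: total_degree_le_def Var_def lookup_single when_def)

lemma total_degree_le_linear_form: "total_degree_le 1 (\<Sum>j\<in>I. Const (c j) * Var (v j))"
  using total_degree_le_mult[OF total_degree_le_Const[of 0] total_degree_le_Var]
  by (intro total_degree_le_sum) simp

lemma total_degree_le_mpoly_eval:
  assumes "total_degree_le d p" and "\<And>i. total_degree_le 1 (\<sigma> i)"
  shows "total_degree_le d (mpoly_eval (\<lambda>c. Const (h c)) \<sigma> p)"
  unfolding mpoly_eval_def
proof (rule total_degree_le_sum)
  fix t assume t: "t \<in> Poly_Mapping.keys p"
  have "total_degree_le (0 + (\<Sum>i\<in>UNIV. Poly_Mapping.lookup t i))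
      (Const (h (Poly_Mapping.lookup p t)) * (\<Prod>i\<in>UNIV. \<sigma> i ^ Poly_Mapping.lookup t i))"
    by (intro total_degree_le_mult total_degree_le_Const total_degree_le_prod total_degree_le_power assms)
  then show "total_degree_le d (Const (h (Poly_Mapping.lookup p t)) * (\<Prod>i\<in>UNIV. \<sigma> i ^ Poly_Mapping.lookup t i))"
    using t assms(1) by (auto simp: total_degree_le_def intro: le_trans)
qed

text \<open>Expanding along one factor, a coefficient of the product is \<open>- f g\<close> times a
  coefficient of the rest plus a neighbouring coefficient, so each factor adds at most 1 to the
  degree.\<close>

lemma total_degree_le_coeff_prod_linear:
  assumes "finite S" "\<And>g. g \<in> S \<Longrightarrow> total_degree_le 1 (f g)"
  shows "total_degree_le (card S) (poly.coeff (\<Prod>g\<in>S. [:- f g, 1:]) k)"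
  using assms
proof (induction S arbitrary: k)
  case empty
  then show ?case by (cases k) (auto simp: total_degree_le_1 total_degree_le_0)
next
  case (insert g S)
  let ?Q = "\<Prod>g\<in>S. [:- f g, 1:]"
  have "total_degree_le (1 + card S) (- f g * poly.coeff ?Q k)"
    using insert by (intro total_degree_le_mult total_degree_le_uminus) auto
  moreover have "total_degree_le (1 + card S) (poly.coeff (pCons 0 ?Q) k)"
    using insert total_degree_le_mono[OF insert.IH] by (cases k) (auto simp: total_degree_le_0)
  ultimately have "total_degree_le (1 + card S) (- f g * poly.coeff ?Q k + poly.coeff (pCons 0 ?Q) k)"
    by (rule total_degree_le_add)
  then show ?case using insert by (simp add: mult_pCons_left)
qed

text \<open>Lets the group act on the coefficients of an orbit polynomial, where invariance is seen
  by permuting factors.\<close>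

lemma is_ring_hom_map_poly:
  assumes f: "is_ring_hom f"
  shows "is_ring_hom (map_poly f)"
proof -
  have "map_poly f (p * q) = map_poly f p * map_poly f q" for p q
    by (rule poly_eqI)
       (simp add: coeff_map_poly is_ring_hom_simps[OF f] coeff_mult is_ring_hom_sum[OF f])
  moreover have "map_poly f (p + q) = map_poly f p + map_poly f q" for p q
    by (rule poly_eqI) (simp add: coeff_map_poly is_ring_hom_simps[OF f])
  ultimately show ?thesis
    by (simp add: is_ring_hom_def map_poly_1 is_ring_hom_simps[OF f])
qed

section \<open>The action on polynomials\<close>

locale matrix_rep = group G for G (structure) +
  fixes A :: "'a \<Rightarrow> (('k::field, 'n::{finite,linorder}) vec, 'n) vec"
  assumes A_mult: "\<And>g h. g \<in> carrier G \<Longrightarrow> h \<in> carrier G \<Longrightarrow> A (g \<otimes> h) = A g ** A h"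
    and A_one: "A \<one> = mat 1"
    and finite_G: "finite (carrier G)"
begin

lemma poly_act_hom: "is_ring_hom (poly_act G A g)"
  unfolding poly_act_def subst_eq_mpoly_eval by (rule mpoly_eval_hom[OF is_ring_hom_Const])

lemma poly_act_Const: "poly_act G A g (Const c) = Const c"
  unfolding poly_act_def subst_eq_mpoly_eval by (rule mpoly_eval_Const[OF is_ring_hom_Const])

lemma poly_act_Var: "poly_act G A g (Var i) = (\<Sum>j\<in>UNIV. Const (A (inv g) $ i $ j) * Var j)"
  unfolding poly_act_def subst_eq_mpoly_eval by (rule mpoly_eval_Var[OF is_ring_hom_Const])

text \<open>Substitution reverses the order of the matrices, and so does the inverse in
  \<open>poly_act\<close>: \<open>A (inv g) ** A (inv h)\<close> is the matrix of
  \<open>inv (h \<otimes> g)\<close>.\<close>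

lemma poly_act_mult:
  assumes g: "g \<in> carrier G" and h: "h \<in> carrier G"
  shows "poly_act G A h (poly_act G A g p) = poly_act G A (h \<otimes> g) p"
proof (rule mpoly_hom_eqI[where f = "\<lambda>p. poly_act G A h (poly_act G A g p)"])
  show "is_ring_hom (\<lambda>p. poly_act G A h (poly_act G A g p))"
    by (rule is_ring_hom_comp[OF poly_act_hom poly_act_hom])
  show "is_ring_hom (poly_act G A (h \<otimes> g))" by (rule poly_act_hom)
  show "poly_act G A h (poly_act G A g (Const c)) = poly_act G A (h \<otimes> g) (Const c)" for c
    by (simp add: poly_act_Const)
  fix i
  have "poly_act G A h (poly_act G A g (Var i))
      = (\<Sum>j\<in>UNIV. \<Sum>l\<in>UNIV. Const (A (inv g) $ i $ j) * Const (A (inv h) $ j $ l) * Var l)"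
    by (simp add: poly_act_Var is_ring_hom_sum[OF poly_act_hom] is_ring_hom_simps[OF poly_act_hom]
        poly_act_Const sum_distrib_left mult.assoc)
  also have "\<dots> = (\<Sum>l\<in>UNIV. Const ((A (inv g) ** A (inv h)) $ i $ l) * Var l)"
    by (subst sum.swap) (simp add: matrix_matrix_mult_def is_ring_hom_sum[OF is_ring_hom_Const]
        is_ring_hom_simps[OF is_ring_hom_Const] sum_distrib_right)
  also have "\<dots> = poly_act G A (h \<otimes> g) (Var i)"
    using g h by (simp add: poly_act_Var inv_mult_group A_mult)
  finally show "poly_act G A h (poly_act G A g (Var i)) = poly_act G A (h \<otimes> g) (Var i)" .
qed

lemma poly_act_one: "poly_act G A \<one> p = p"
proof (rule mpoly_hom_eqI[OF poly_act_hom is_ring_hom_id])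
  fix i
  have "poly_act G A \<one> (Var i) = (\<Sum>j\<in>UNIV. if j = i then Var i else 0)"
    unfolding poly_act_Var
    by (intro sum.cong) (auto simp: A_one mat_def is_ring_hom_simps[OF is_ring_hom_Const])
  then show "poly_act G A \<one> (Var i) = Var i" by simp
qed (rule poly_act_Const)

text \<open>Injectivity is what makes \<open>fract_map\<close> well defined for the action.\<close>

lemma inj_poly_act:
  assumes "g \<in> carrier G" shows "inj (poly_act G A g)"
  by (rule inj_on_inverseI[of _ "poly_act G A (inv g)"])
     (use assms in \<open>simp add: poly_act_mult poly_act_one\<close>)

lemma fract_map_poly_act:
  assumes "g \<in> carrier G" "b \<noteq> 0"
  shows "fract_map (poly_act G A g) (Fract a b) = Fract (poly_act G A g a) (poly_act G A g b)"
  using assms by (intro fract_map_Fract inj_poly_act) (auto simp: is_ring_hom_simps[OF poly_act_hom])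

lemma is_ring_hom_fract_map:
  assumes g: "g \<in> carrier G"
  shows "is_ring_hom (fract_map (poly_act G A g))"
proof -
  have nz: "poly_act G A g b \<noteq> 0" if "b \<noteq> 0" for b
    using inj_poly_act[OF g] that by (metis injD is_ring_hom_simps(1) poly_act_hom)
  have "fract_map (poly_act G A g) (x + y) = fract_map (poly_act G A g) x + fract_map (poly_act G A g) y
    \<and> fract_map (poly_act G A g) (x * y) = fract_map (poly_act G A g) x * fract_map (poly_act G A g) y" for x y
    by (cases x; cases y)
       (simp add: fract_map_poly_act[OF g] nz is_ring_hom_simps[OF poly_act_hom])
  moreover have "fract_map (poly_act G A g) 0 = 0" "fract_map (poly_act G A g) 1 = 1"
    by (simp_all add: Zero_fract_def One_fract_def fract_map_poly_act[OF g] is_ring_hom_simps[OF poly_act_hom])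
  ultimately show ?thesis by (simp add: is_ring_hom_def)
qed

lemma Fract_rational_invariant:
  assumes "\<And>g. g \<in> carrier G \<Longrightarrow> poly_act G A g p = p"
  shows "Fract p 1 \<in> rational_invariants G A"
  using assms unfolding rational_invariants_def
  by (auto simp: fract_map_poly_act is_ring_hom_simps[OF poly_act_hom])

lemma subfield_rational_invariants: "subfield (rational_invariants G A) ring_of_type_algebra"
proof -
  interpret R: field "ring_of_type_algebra :: ('n, 'k) mpoly fract ring"
    by (rule field_from_type_algebra)
  have inverse: "inverse x \<in> rational_invariants G A" if x: "x \<in> rational_invariants G A" "x \<noteq> 0" for x
    unfolding rational_invariants_def
  proof (intro CollectI ballI)
    fix g assume g: "g \<in> carrier G"
    note hom = is_ring_hom_simps[OF is_ring_hom_fract_map[OF g]]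
    have "x * fract_map (poly_act G A g) (inverse x) = fract_map (poly_act G A g) (x * inverse x)"
      using x g by (subst hom(4)) (simp add: rational_invariants_def)
    also have "\<dots> = 1" using x(2) by (simp add: hom(2))
    finally show "fract_map (poly_act G A g) (inverse x) = inverse x"
      by (metis inverse_unique)
  qed
  show ?thesis
  proof (rule R.subfieldI'[OF R.subringI])
    fix k assume "k \<in> rational_invariants G A - {\<zero>\<^bsub>ring_of_type_algebra\<^esub>}"
    then show "inv\<^bsub>ring_of_type_algebra\<^esub> k \<in> rational_invariants G A"
      using inverse by (simp add: ring_of_type_algebra_m_inv)
  qed (auto simp: rational_invariants_def is_ring_hom_simps[OF is_ring_hom_fract_map]
      is_ring_hom_uminus[OF is_ring_hom_fract_map])
qed

lemma subfield_field_gen: "subfield (field_gen S) (ring_of_type_algebra :: ('n, 'k) mpoly fract ring)"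
proof -
  interpret R: field "ring_of_type_algebra :: ('n, 'k) mpoly fract ring"
    by (rule field_from_type_algebra)
  show ?thesis unfolding field_gen_def by (rule R.generate_field_is_subfield) auto
qed

lemma Fract_field_gen: "p \<in> range Const \<union> S \<Longrightarrow> Fract p 1 \<in> field_gen S"
  unfolding field_gen_def by (intro generate_field.incl) auto

lemma field_gen_subset_rational_invariants:
  "field_gen (poly_invariants_le G A d) \<subseteq> rational_invariants G A"
proof -
  interpret R: field "ring_of_type_algebra :: ('n, 'k) mpoly fract ring"
    by (rule field_from_type_algebra)
  show ?thesis
    unfolding field_gen_def
  proof (rule R.generate_field_min_subfield1[OF _ subfield_rational_invariants])
    show "(\<lambda>p. Fract p 1) ` (range Const \<union> poly_invariants_le G A d) \<subseteq> rational_invariants G A"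
      by (auto simp: poly_invariants_le_def poly_act_Const intro!: Fract_rational_invariant)
  qed simp
qed

section \<open>Finiteness of the extension in degree \<open>card (carrier G)\<close>\<close>

lemma algebraic_Var:
  "\<not> ring.transcendental ring_of_type_algebra (field_gen (poly_invariants_le G A (card (carrier G)))) (Fract (Var i) 1)"
proof -
  interpret R: field "ring_of_type_algebra :: ('n, 'k) mpoly fract ring"
    by (rule field_from_type_algebra)
  let ?N = "card (carrier G)"
  let ?F = "field_gen (poly_invariants_le G A ?N)"
  define Q where "Q = (\<Prod>g\<in>carrier G. [:- poly_act G A g (Var i), 1:])"
  \<comment> \<open>Acting by \<open>h\<close> on the coefficients permutes the factors of the orbit
    polynomial \<open>Q\<close>.\<close>
  have inv: "poly_act G A h (poly.coeff Q k) = poly.coeff Q k" if h: "h \<in> carrier G" for h k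
  proof -
    note hom = is_ring_hom_map_poly[OF poly_act_hom, of h]
    have "map_poly (poly_act G A h) Q = (\<Prod>g\<in>carrier G. [:- poly_act G A (h \<otimes> g) (Var i), 1:])"
      unfolding Q_def is_ring_hom_prod[OF hom]
      by (intro prod.cong) (auto simp: map_poly_pCons is_ring_hom_simps[OF poly_act_hom]
          is_ring_hom_uminus[OF poly_act_hom] poly_act_mult h)
    also have "\<dots> = Q"
      unfolding Q_def
      by (rule prod.reindex_bij_witness[of _ "\<lambda>g. inv h \<otimes> g" "\<lambda>g. h \<otimes> g"])
         (use h in \<open>auto simp: m_assoc[symmetric]\<close>)
    finally show ?thesis
      by (metis coeff_map_poly is_ring_hom_simps(1) poly_act_hom)
  qed
  have "total_degree_le ?N (poly.coeff Q k)" for k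
    unfolding Q_def poly_act_Var
    by (intro total_degree_le_coeff_prod_linear finite_G total_degree_le_linear_form)
  then have coeff: "Fract (poly.coeff Q k) 1 \<in> ?F" for k
    using inv by (intro Fract_field_gen) (auto simp: poly_invariants_le_def)
  have "poly.coeff Q (Polynomial.degree Q) = 1"
    unfolding Q_def by (simp add: lead_coeff_prod)
  \<comment> \<open>\<open>Q\<close> as a coefficient list. Since \<open>Q\<close> is monic, the
    list starts with 1, as a polynomial with nonzero leading coefficient must.\<close>
  define L where "L = map (\<lambda>k. Fract (poly.coeff Q k) 1) (rev [0..<Suc (Polynomial.degree Q)])"
  show ?thesis
  proof (rule R.algebraicI[unfolded over_def, of L])
    show "L \<noteq> []" by (simp add: L_def)
    have "hd L = 1" using \<open>poly.coeff Q (Polynomial.degree Q) = 1\<close> by (simp add: L_def One_fract_def)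
    moreover have "set L \<subseteq> ?F" using coeff by (auto simp: L_def)
    ultimately show "L \<in> carrier (?F [X]\<^bsub>ring_of_type_algebra\<^esub>)"
      by (simp add: univ_poly_carrier[symmetric] polynomial_def)
    note F = is_ring_hom_Fract[where 'a = "('n, 'k) mpoly"]
    have "R.eval L (Fract (Var i) 1) = (\<Sum>k<Suc (Polynomial.degree Q). Fract (poly.coeff Q k) 1 * Fract (Var i) 1 ^ k)"
      unfolding L_def by (rule ring_of_type_algebra_eval)
    also have "\<dots> = Fract (poly Q (Var i)) 1"
      by (simp only: is_ring_hom_sum[OF F] is_ring_hom_simps[OF F] is_ring_hom_power[OF F] poly_altdef
          lessThan_Suc_atMost)
    also have "poly Q (Var i) = 0"
    proof -
      have "poly [:- poly_act G A \<one> (Var i), 1:] (Var i) = 0" by (simp add: poly_act_one)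
      then show ?thesis
        unfolding Q_def poly_prod using finite_G by (intro prod_zero) (auto intro!: bexI[of _ \<one>])
    qed
    finally show "R.eval L (Fract (Var i) 1) = \<zero>\<^bsub>ring_of_type_algebra\<^esub>"
      by (simp add: Zero_fract_def)
  qed
qed

text \<open>Shows that the \<open>LEAST\<close> in \<open>gamma_field\<close> is attained. Adjoining
  the coordinate functions, which are algebraic over \<open>?F\<close>, gives a finite extension
  that contains every fraction; the invariants form a subspace of it.\<close>

lemma finite_dimension_card:
  "ring.finite_dimension ring_of_type_algebra
     (field_gen (poly_invariants_le G A (card (carrier G)))) (rational_invariants G A)"
proof -
  let ?R = "ring_of_type_algebra :: ('n, 'k) mpoly fract ring"
  interpret R: field ?R by (rule field_from_type_algebra)
  let ?F = "field_gen (poly_invariants_le G A (card (carrier G)))"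
  obtain xs where xs: "set xs = range (\<lambda>i. Fract (Var i) 1 :: ('n, 'k) mpoly fract)"
    using finite_list[of "range (\<lambda>i. Fract (Var i) 1 :: ('n, 'k) mpoly fract)"] by auto
  have alg: "\<And>x. x \<in> set xs \<Longrightarrow> (R.algebraic over ?F) x"
    using algebraic_Var by (auto simp: xs over_def)
  define E where "E = R.finite_extension ?F xs"
  have fin: "R.finite_dimension ?F E"
    using R.finite_extension_finite_dimension(1)[OF subfield_field_gen _ alg] by (simp add: E_def)
  have subf: "subfield E ?R"
    using R.finite_extension_is_subfield[OF subfield_field_gen _ alg] by (simp add: E_def)
  have FE: "?F \<subseteq> E"
    unfolding E_def by (rule R.finite_extension_incl) auto
  have subr: "subring E ?R" using subf by (rule subfieldE(1))
  have closed: "1 \<in> E" "x * y \<in> E" "x + y \<in> E" if "x \<in> E" "y \<in> E" for x y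
    using subringE(3)[OF subr] subringE(6,7)[OF subr that] by simp_all
  have "1 \<in> E" "0 \<in> E" using subringE(2,3)[OF subr] by simp_all
  note F = is_ring_hom_Fract[where 'a = "('n, 'k) mpoly"]
  have pow: "x ^ n \<in> E" if "x \<in> E" for x and n :: nat
    by (induction n) (use closed that \<open>1 \<in> E\<close> in auto)
  have prodE: "prod f B \<in> E" if "\<And>x. x \<in> B \<Longrightarrow> f x \<in> E" for f and B :: "'n set"
    using that by (induction B rule: infinite_finite_induct) (use closed \<open>1 \<in> E\<close> in auto)
  have sumE: "sum f B \<in> E" if "\<And>x. x \<in> B \<Longrightarrow> f x \<in> E" for f and B :: "('n \<Rightarrow>\<^sub>0 nat) set"
    using that by (induction B rule: infinite_finite_induct) (use closed \<open>0 \<in> E\<close> in auto)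
  have varE: "Fract (Var i) 1 \<in> E" for i
    using R.finite_extension_mem[OF subfieldE(1)[OF subfield_field_gen], of xs] xs by (auto simp: E_def)
  have constE: "Fract (Const c) 1 \<in> E" for c
    using FE Fract_field_gen[of "Const c"] by auto
  have poly: "Fract p 1 \<in> E" for p
    by (subst mpoly_sum_monomials[of p])
       (auto simp: is_ring_hom_sum[OF F] single_eq_Const_Var is_ring_hom_simps[OF F]
         is_ring_hom_prod[OF F] is_ring_hom_power[OF F] intro!: sumE closed prodE pow varE constE)
  have "q \<in> E" for q
  proof (cases q)
    case (Fract a b)
    then have "Fract b 1 \<noteq> 0" by (simp add: Zero_fract_def eq_fract)
    then have "inverse (Fract b 1) \<in> E"
      using R.subfield_m_inv(1)[OF subf, of "Fract b 1"] poly by (simp add: ring_of_type_algebra_m_inv)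
    then have "Fract a 1 * inverse (Fract b 1) \<in> E" by (intro closed poly)
    then show ?thesis using Fract by simp
  qed
  then have "rational_invariants G A \<subseteq> E" by blast
  moreover have "subalgebra ?F (rational_invariants G A) ?R"
  proof (rule subalgebra.intro)
    note sr = subfieldE(1)[OF subfield_rational_invariants]
    show "subgroup (rational_invariants G A) (add_monoid ?R)"
      using subring.axioms(1)[OF sr] .
    show "subalgebra_axioms ?F (rational_invariants G A) ?R"
      using field_gen_subset_rational_invariants subringE(6)[OF sr]
      by (intro subalgebra_axioms.intro) blast
  qed
  ultimately show ?thesis
    using R.subalbegra_incl_imp_finite_dimension[OF subfield_field_gen fin] by blast
qed

end

section \<open>Transcendence from a grading\<close>

text \<open>Unlike a bound on \<open>top_weight\<close>, this is meaningful for the zero polynomial,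
  which can occur as a numerator below.\<close>

definition weights_le :: "('n::finite \<Rightarrow> real) \<Rightarrow> real \<Rightarrow> ('n, 'k::field) mpoly \<Rightarrow> bool" where
  "weights_le w r p \<longleftrightarrow> (\<forall>t\<in>Poly_Mapping.keys p. weight w t \<le> r)"

definition weightless :: "('n::finite \<Rightarrow> real) \<Rightarrow> ('n, 'k::field) mpoly \<Rightarrow> bool" where
  "weightless w p \<longleftrightarrow> (\<forall>t\<in>Poly_Mapping.keys p. weight w t = 0)"

lemma weights_le_0: "weights_le w r 0"
  by (simp add: weights_le_def)

lemma weights_le_add: "weights_le w r p \<Longrightarrow> weights_le w r q \<Longrightarrow> weights_le w r (p + q)"
  using keys_add[of p q] unfolding weights_le_def by blast

lemma weights_le_mult:
  assumes "weights_le w r p" "weights_le w s q" shows "weights_le w (r + s) (p * q)"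
  unfolding weights_le_def
proof
  fix t assume "t \<in> Poly_Mapping.keys (p * q)"
  then obtain x y where "t = x + y" "x \<in> Poly_Mapping.keys p" "y \<in> Poly_Mapping.keys q"
    using keys_mult[of p q] by blast
  then show "weight w t \<le> r + s"
    using assms by (auto simp: weights_le_def weight_add intro!: add_mono)
qed

lemma weights_le_mono: "weights_le w r p \<Longrightarrow> r \<le> s \<Longrightarrow> weights_le w s p"
  unfolding weights_le_def by force

lemma weightless_add: "weightless w p \<Longrightarrow> weightless w q \<Longrightarrow> weightless w (p + q)"
  using keys_add[of p q] unfolding weightless_def by blast

lemma weightless_uminus: "weightless w p \<Longrightarrow> weightless w (- p)"
  by (simp add: weightless_def in_keys_iff)

lemma weightless_mult:
  assumes "weightless w p" "weightless w q" shows "weightless w (p * q)"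
  unfolding weightless_def
proof
  fix t assume "t \<in> Poly_Mapping.keys (p * q)"
  then obtain x y where "t = x + y" "x \<in> Poly_Mapping.keys p" "y \<in> Poly_Mapping.keys q"
    using keys_mult[of p q] by blast
  then show "weight w t = 0"
    using assms by (simp add: weightless_def weight_add)
qed

lemma weightless_1: "weightless w 1"
  by (simp add: weightless_def weight_def)

lemma weightless_imp_weights_le: "weightless w p \<Longrightarrow> weights_le w 0 p"
  by (simp add: weightless_def weights_le_def)

lemma weightless_top: "weightless w p \<Longrightarrow> p \<noteq> 0 \<Longrightarrow> top_weight w p = 0"
  by (metis top_weight_attained weightless_def)

lemma weights_le_top: "weights_le w (top_weight w p) p"
  by (simp add: weights_le_def weight_le_top)

lemma top_weight_prod:
  fixes f :: "'x \<Rightarrow> ('n::{finite,linorder}, 'k::field) mpoly"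
  assumes "finite S" "\<And>x. x \<in> S \<Longrightarrow> f x \<noteq> 0"
  shows "top_weight w (prod f S) = (\<Sum>x\<in>S. top_weight w (f x))"
  using assms by induction (auto simp: weightless_top weightless_1 top_weight_mult)

lemma top_weight_power:
  fixes p :: "('n::{finite,linorder}, 'k::field) mpoly"
  assumes "p \<noteq> 0" shows "top_weight w (p ^ n) = real n * top_weight w p"
  using assms by (induction n) (auto simp: weightless_top weightless_1 top_weight_mult algebra_simps)

text \<open>Fractions live over \<open>k\<close>, while weights are taken of the images over
  \<open>K\<close>. Injectivity keeps denominators and leading terms nonzero.\<close>

locale graded_embedding =
  fixes \<phi> :: "('n::{finite,linorder}, 'k::field) mpoly \<Rightarrow> ('n, 'K::field) mpoly" and w :: "'n \<Rightarrow> real"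
  assumes hom: "is_ring_hom \<phi>" and inj: "inj \<phi>"
begin

lemma nonzero: "p \<noteq> 0 \<Longrightarrow> \<phi> p \<noteq> 0"
  using inj is_ring_hom_simps(1)[OF hom] by (metis injD)

definition weightless_fracts :: "('n, 'k) mpoly fract set" where
  "weightless_fracts = {Fract a b | a b. b \<noteq> 0 \<and> weightless w (\<phi> a) \<and> weightless w (\<phi> b)}"

text \<open>Induction over the generation of the field: sums, products and inverses can again be
  written with weightless numerators and denominators.\<close>

lemma field_gen_subset_weightless_fracts:
  assumes S: "\<And>p. p \<in> range Const \<union> S \<Longrightarrow> weightless w (\<phi> p)"
  shows "field_gen S \<subseteq> weightless_fracts"
proof
  have one: "weightless w (\<phi> 1)" by (simp add: is_ring_hom_simps[OF hom] weightless_1)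
  fix q assume "q \<in> field_gen S"
  then show "q \<in> weightless_fracts"
    unfolding field_gen_def
  proof induction
    case one
    show ?case
      unfolding weightless_fracts_def using \<open>weightless w (\<phi> 1)\<close>
      by (auto simp: One_fract_def intro!: exI[of _ 1])
  next
    case (incl h)
    then obtain p where "h = Fract p 1" "p \<in> range Const \<union> S" by blast
    then show ?case
      unfolding weightless_fracts_def using one S by (intro CollectI exI[of _ p] exI[of _ 1]) auto
  next
    case (a_inv h)
    then obtain a b where "h = Fract a b" "b \<noteq> 0" "weightless w (\<phi> a)" "weightless w (\<phi> b)"
      unfolding weightless_fracts_def by blast
    then show ?case
      unfolding weightless_fracts_def
      by (intro CollectI exI[of _ "- a"] exI[of _ b]) (simp add: is_ring_hom_uminus[OF hom] weightless_uminus)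
  next
    case (m_inv h)
    then obtain a b where h: "h = Fract a b" "b \<noteq> 0" "weightless w (\<phi> a)" "weightless w (\<phi> b)"
      unfolding weightless_fracts_def by blast
    with m_inv have "a \<noteq> 0" by (auto simp: Zero_fract_def eq_fract)
    then show ?case
      unfolding weightless_fracts_def using h m_inv(2)
      by (intro CollectI exI[of _ b] exI[of _ a]) (simp add: ring_of_type_algebra_m_inv)
  next
    case (eng_add h1 h2)
    then obtain a b c d where "h1 = Fract a b" "b \<noteq> 0" "weightless w (\<phi> a)" "weightless w (\<phi> b)"
      "h2 = Fract c d" "d \<noteq> 0" "weightless w (\<phi> c)" "weightless w (\<phi> d)"
      unfolding weightless_fracts_def by blast
    then show ?case
      unfolding weightless_fracts_def
      by (intro CollectI exI[of _ "a * d + c * b"] exI[of _ "b * d"])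
         (simp add: is_ring_hom_simps[OF hom] weightless_add weightless_mult)
  next
    case (eng_mult h1 h2)
    then obtain a b c d where "h1 = Fract a b" "b \<noteq> 0" "weightless w (\<phi> a)" "weightless w (\<phi> b)"
      "h2 = Fract c d" "d \<noteq> 0" "weightless w (\<phi> c)" "weightless w (\<phi> d)"
      unfolding weightless_fracts_def by blast
    then show ?case
      unfolding weightless_fracts_def
      by (intro CollectI exI[of _ "a * c"] exI[of _ "b * d"])
         (simp add: is_ring_hom_simps[OF hom] weightless_mult)
  qed
qed

text \<open>Over a weightless denominator, the term of exponent \<open>k\<close> has a numerator of
  weight at most \<open>k\<close> times that of \<open>f\<close>. If the weight of \<open>f\<close>
  is positive, the leading term stands alone on top and cannot cancel. The degree appears as
  \<open>real (length p) - 1\<close>, which is -1 for the empty list; the numerator is then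
  0.\<close>

lemma eval_weight_bound:
  fixes f :: "('n, 'k) mpoly"
  assumes "top_weight w (\<phi> f) \<ge> 0" and "f \<noteq> 0" and "set p \<subseteq> weightless_fracts"
  shows "\<exists>a b. b \<noteq> 0 \<and> ring.eval ring_of_type_algebra p (Fract f 1) = Fract a b \<and> weightless w (\<phi> b) \<and>
    weights_le w ((real (length p) - 1) * top_weight w (\<phi> f)) (\<phi> a)
    \<and> (p \<noteq> [] \<longrightarrow> hd p \<noteq> 0 \<longrightarrow> top_weight w (\<phi> f) > 0 \<longrightarrow> a \<noteq> 0)"
  using assms(3)
proof (induction p)
  case Nil
  interpret R: ring "ring_of_type_algebra :: ('n, 'k) mpoly fract ring" by (rule ring_from_type_algebra)
  show ?case
    by (intro exI[of _ 0] exI[of _ 1]) (simp add: Zero_fract_def is_ring_hom_simps[OF hom] weightless_1 weights_le_0)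
next
  case (Cons c p)
  interpret R: ring "ring_of_type_algebra :: ('n, 'k) mpoly fract ring" by (rule ring_from_type_algebra)
  let ?v = "top_weight w (\<phi> f)" and ?n = "length p"
  obtain a b where ab: "b \<noteq> 0" "R.eval p (Fract f 1) = Fract a b" "weightless w (\<phi> b)"
    "weights_le w ((real ?n - 1) * ?v) (\<phi> a)"
    using Cons by auto
  obtain a' b' where c: "c = Fract a' b'" "b' \<noteq> 0" "weightless w (\<phi> a')" "weightless w (\<phi> b')"
    using Cons(2) unfolding weightless_fracts_def by auto
  note F = is_ring_hom_Fract[where 'a = "('n, 'k) mpoly"]
  \<comment> \<open>The numerator of the leading term over the denominator \<open>b' * b\<close>;
    the remaining terms contribute \<open>a * b'\<close>.\<close>
  define x where "x = a' * f ^ ?n * b"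
  have "R.eval (c # p) (Fract f 1) = c * Fract (f ^ ?n) 1 + Fract a b"
    using ab(2) by (simp add: is_ring_hom_power[OF F])
  also have "\<dots> = Fract (x + a * b') (b' * b)"
    using ab(1) c(1,2) by (simp add: x_def)
  finally have eval: "R.eval (c # p) (Fract f 1) = Fract (x + a * b') (b' * b)" .
  have \<phi>x: "\<phi> x = \<phi> a' * \<phi> f ^ ?n * \<phi> b" and \<phi>s: "\<phi> (x + a * b') = \<phi> x + \<phi> a * \<phi> b'"
    by (simp_all add: x_def is_ring_hom_simps[OF hom] is_ring_hom_power[OF hom])
  have f0: "\<phi> f \<noteq> 0" by (rule nonzero) fact
  have "weights_le w (0 + real ?n * ?v + 0) (\<phi> x)"
    unfolding \<phi>x top_weight_power[OF f0, symmetric]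
    by (intro weights_le_mult weightless_imp_weights_le weights_le_top c ab)
  \<comment> \<open>The lower terms stay below the leading one by a full \<open>?v\<close>.\<close>
  moreover have low: "weights_le w ((real ?n - 1) * ?v + 0) (\<phi> a * \<phi> b')"
    by (intro weights_le_mult weightless_imp_weights_le c ab)
  then have "weights_le w (real ?n * ?v) (\<phi> a * \<phi> b')"
    by (rule weights_le_mono) (use assms(1) in \<open>simp add: algebra_simps\<close>)
  ultimately have "weights_le w (real ?n * ?v) (\<phi> (x + a * b'))"
    unfolding \<phi>s by (simp add: weights_le_add)
  moreover have "x + a * b' \<noteq> 0" if "c \<noteq> 0" "?v > 0"
  proof -
    have "a' \<noteq> 0" using that(1) c by (auto simp: Zero_fract_def eq_fract)
    then have nz: "\<phi> a' \<noteq> 0" "\<phi> b \<noteq> 0" using nonzero ab(1) by auto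
    then have "top_weight w (\<phi> x) = real ?n * ?v"
      using f0 ab c by (simp add: \<phi>x top_weight_mult top_weight_power weightless_top)
    moreover have "(real ?n - 1) * ?v < real ?n * ?v" using that(2) by (simp add: algebra_simps)
    ultimately have "\<phi> x + \<phi> a * \<phi> b' \<noteq> 0"
      using nz f0 low by (intro top_weight_add_less(1)[where w = w]) (force simp: \<phi>x weights_le_def)+
    then show ?thesis
      using \<phi>s is_ring_hom_simps(1)[OF hom] by metis
  qed
  ultimately show ?case
    using eval ab c
    by (intro exI[of _ "x + a * b'"] exI[of _ "b' * b"]) (simp add: is_ring_hom_simps[OF hom] weightless_mult)
qed

text \<open>An algebraic relation would have coefficients in \<open>weightless_fracts\<close>, so by
  \<open>eval_weight_bound\<close> its value would have a nonzero numerator.\<close>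

lemma transcendental_if_positive_weight:
  assumes S: "\<And>p. p \<in> range Const \<union> S \<Longrightarrow> weightless w (\<phi> p)"
    and f: "top_weight w (\<phi> f) > 0" "f \<noteq> 0"
  shows "ring.transcendental ring_of_type_algebra (field_gen S) (Fract f 1)"
proof (rule ccontr)
  let ?R = "ring_of_type_algebra :: ('n, 'k) mpoly fract ring"
  interpret R: field ?R by (rule field_from_type_algebra)
  assume alg: "\<not> R.transcendental (field_gen S) (Fract f 1)"
  have "subring (field_gen S) ?R"
    unfolding field_gen_def by (rule subfieldE(1)[OF R.generate_field_is_subfield]) simp
  then obtain p where p: "p \<in> carrier (field_gen S [X]\<^bsub>?R\<^esub>)" "p \<noteq> []" "R.eval p (Fract f 1) = 0"
    using R.algebraicE[unfolded over_def, of "field_gen S" "Fract f 1"] alg by auto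
  then have p': "set p \<subseteq> field_gen S" "hd p \<noteq> 0"
    by (auto simp: univ_poly_carrier[symmetric] polynomial_def)
  have "field_gen S \<subseteq> weightless_fracts"
    by (rule field_gen_subset_weightless_fracts) (rule S)
  with p'(1) have "set p \<subseteq> weightless_fracts" by blast
  then obtain a b where "b \<noteq> 0" "R.eval p (Fract f 1) = Fract a b" "a \<noteq> 0"
    using eval_weight_bound[of f p] f p(2) p'(2) by auto
  with p(3) show False by (simp add: Zero_fract_def eq_fract)
qed

end

section \<open>Linear changes of variables\<close>

text \<open>A diagonal substitution never mixes monomials. This turns invariance of a polynomial
  into a condition on each of its monomials.\<close>

lemma mpoly_eval_scaled_vars:
  fixes p :: "('n::finite, 'k::field) mpoly" and h :: "'k \<Rightarrow> 'K::field"
  assumes h: "is_ring_hom h"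
  shows "Poly_Mapping.lookup (mpoly_eval (\<lambda>c. Const (h c)) (\<lambda>i. Const (e i) * Var i) p) t
    = h (Poly_Mapping.lookup p t) * (\<Prod>i\<in>UNIV. e i ^ Poly_Mapping.lookup t i)"
proof -
  note C = is_ring_hom_Const[where 'k = 'K and 'n = 'n]
  have "mpoly_eval (\<lambda>c. Const (h c)) (\<lambda>i. Const (e i) * Var i) p = (\<Sum>s\<in>Poly_Mapping.keys p.
      Poly_Mapping.single s (h (Poly_Mapping.lookup p s) * (\<Prod>i\<in>UNIV. e i ^ Poly_Mapping.lookup s i)))"
    unfolding mpoly_eval_def
    by (intro sum.cong) (simp_all add: single_eq_Const_Var power_mult_distrib prod.distrib
        is_ring_hom_prod[OF C] is_ring_hom_power[OF C] is_ring_hom_simps[OF C])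
  then have "Poly_Mapping.lookup (mpoly_eval (\<lambda>c. Const (h c)) (\<lambda>i. Const (e i) * Var i) p) t
      = (\<Sum>s\<in>Poly_Mapping.keys p. if s = t then h (Poly_Mapping.lookup p t)
          * (\<Prod>i\<in>UNIV. e i ^ Poly_Mapping.lookup t i) else 0)"
    by (auto simp: lookup_sum lookup_single when_def intro!: sum.cong)
  also have "\<dots> = h (Poly_Mapping.lookup p t) * (\<Prod>i\<in>UNIV. e i ^ Poly_Mapping.lookup t i)"
    by (simp add: in_keys_iff is_ring_hom_simps[OF h])
  finally show ?thesis .
qed

text \<open>A combination of the columns of \<open>P\<close> with coefficients y_i has as j-th
  coordinate the sum over i of \<open>P $ j $ i\<close> times y_i. So the polynomial is rewritten in
  the coordinates dual to the columns of \<open>P\<close>.\<close>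

definition base_change :: "('k::field \<Rightarrow> 'K::field) \<Rightarrow> 'K ^ 'n ^ 'n::finite \<Rightarrow> ('n, 'k) mpoly \<Rightarrow> ('n, 'K) mpoly" where
  "base_change h P = mpoly_eval (\<lambda>c. Const (h c)) (\<lambda>j. \<Sum>i\<in>UNIV. Const (P $ j $ i) * Var i)"

lemma is_ring_hom_Const_comp: "is_ring_hom h \<Longrightarrow> is_ring_hom (\<lambda>c. Const (h c))"
  by (rule is_ring_hom_comp[OF is_ring_hom_Const])

lemma base_change_hom: "is_ring_hom h \<Longrightarrow> is_ring_hom (base_change h P)"
  unfolding base_change_def by (intro mpoly_eval_hom is_ring_hom_Const_comp)

lemma base_change_Const: "is_ring_hom h \<Longrightarrow> base_change h P (Const c) = Const (h c)"
  unfolding base_change_def by (intro mpoly_eval_Const is_ring_hom_Const_comp)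

lemma base_change_Var:
  "is_ring_hom h \<Longrightarrow> base_change h P (Var j) = (\<Sum>i\<in>UNIV. Const (P $ j $ i) * Var i)"
  unfolding base_change_def by (intro mpoly_eval_Var is_ring_hom_Const_comp)

lemma base_change_mult:
  fixes h :: "'k::field \<Rightarrow> 'K::field"
  assumes h: "is_ring_hom h"
  shows "base_change (\<lambda>c. c) Q (base_change h P p) = base_change h (P ** Q) p"
proof (rule mpoly_hom_eqI[where f = "\<lambda>p. base_change (\<lambda>c. c) Q (base_change h P p)"])
  note hQ = base_change_hom[OF is_ring_hom_id, of Q]
  note C = is_ring_hom_Const[where 'k = 'K and 'n = 'n]
  show "is_ring_hom (\<lambda>p. base_change (\<lambda>c. c) Q (base_change h P p))"
    by (rule is_ring_hom_comp[OF hQ base_change_hom[OF h]])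
  show "is_ring_hom (base_change h (P ** Q))" by (rule base_change_hom[OF h])
  show "base_change (\<lambda>c. c) Q (base_change h P (Const c)) = base_change h (P ** Q) (Const c)" for c
    by (simp add: base_change_Const[OF h] base_change_Const[OF is_ring_hom_id])
  fix j
  have "base_change (\<lambda>c. c) Q (base_change h P (Var j))
      = (\<Sum>i\<in>UNIV. \<Sum>l\<in>UNIV. Const (P $ j $ i) * Const (Q $ i $ l) * Var l)"
    by (simp add: base_change_Var[OF h] is_ring_hom_sum[OF hQ] is_ring_hom_simps[OF hQ]
        base_change_Const[OF is_ring_hom_id] base_change_Var[OF is_ring_hom_id] sum_distrib_left mult.assoc)
  also have "\<dots> = base_change h (P ** Q) (Var j)"
    unfolding base_change_Var[OF h]
    by (subst sum.swap) (simp add: matrix_matrix_mult_def is_ring_hom_sum[OF C]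
        is_ring_hom_simps[OF C] sum_distrib_right)
  finally show "base_change (\<lambda>c. c) Q (base_change h P (Var j)) = base_change h (P ** Q) (Var j)" .
qed

text \<open>A right inverse of \<open>P\<close> undoes the change of variables and leaves
  \<open>h\<close> acting on coefficients, which is injective because \<open>h\<close> is a
  homomorphism of fields.\<close>

lemma inj_base_change:
  fixes h :: "'k::field \<Rightarrow> 'K::field" and P :: "'K ^ 'n ^ 'n::finite"
  assumes h: "is_ring_hom h" and P: "invertible P"
  shows "inj (base_change h P)"
proof (rule is_ring_hom_injI[OF base_change_hom[OF h]])
  fix p assume "base_change h P p = 0"
  obtain Q where "P ** Q = mat 1" using P by (auto simp: invertible_def)
  then have "base_change h (mat 1) p = base_change (\<lambda>c. c) Q (base_change h P p)"
    by (simp add: base_change_mult[OF h])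
  also have "\<dots> = 0"
    using \<open>base_change h P p = 0\<close> by (simp add: is_ring_hom_simps(1) base_change_hom is_ring_hom_id)
  finally have "base_change h (mat 1) p = 0" .
  \<comment> \<open>The identity matrix is brought into the form of a rescaling with factors 1, so
    that coefficients can be read off.\<close>
  moreover have "(\<Sum>i\<in>UNIV. Const ((mat 1 :: 'K ^ 'n ^ 'n) $ j $ i) * Var i) = Const 1 * Var j" for j
  proof -
    have "(\<Sum>i\<in>UNIV. Const ((mat 1 :: 'K ^ 'n ^ 'n) $ j $ i) * Var i)
        = (\<Sum>i\<in>UNIV. if i = j then Const 1 * Var j else 0)"
      by (intro sum.cong) (auto simp: mat_def is_ring_hom_simps[OF is_ring_hom_Const])
    then show ?thesis by simp
  qed
  ultimately have "mpoly_eval (\<lambda>c. Const (h c)) (\<lambda>j. Const 1 * Var j) p = 0"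
    by (simp add: base_change_def)
  then have "h (Poly_Mapping.lookup p t) = 0" for t
    using mpoly_eval_scaled_vars[OF h, of "\<lambda>_. 1" p t] by simp
  then have "Poly_Mapping.lookup p t = 0" for t
    using is_ring_hom_field_inj[OF h] is_ring_hom_simps(1)[OF h] by (metis injD)
  then show "p = 0" by (intro poly_mapping_eqI) simp
qed

lemma lookup_base_change_Var:
  fixes P :: "'K::field ^ 'n ^ 'n::finite"
  assumes "is_ring_hom h"
  shows "Poly_Mapping.lookup (base_change h P (Var j)) (Poly_Mapping.single i 1) = P $ j $ i"
proof -
  have "base_change h P (Var j) = (\<Sum>l\<in>UNIV. Poly_Mapping.single (Poly_Mapping.single l 1) (P $ j $ l))"
    unfolding base_change_Var[OF assms] by (simp add: Const_def Var_def mult_single)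
  moreover have "(Poly_Mapping.single l (1::nat) = Poly_Mapping.single i 1) = (l = i)" for l i :: 'n
    by (metis lookup_single_eq lookup_single_not_eq zero_neq_one)
  ultimately show ?thesis by (simp add: lookup_sum lookup_single when_def)
qed

section \<open>Diagonalised representations\<close>

lemma matrix_vector_mult_axis: "M *v axis k 1 = column k (M :: 'a::field ^ 'n ^ 'm)"
proof -
  have "(\<Sum>j\<in>UNIV. M $ i $ j * axis k 1 $ j) = (\<Sum>j\<in>UNIV. if j = k then M $ i $ k else 0)" for i
    by (intro sum.cong) (auto simp: axis_def)
  then show ?thesis by (simp add: vec_eq_iff matrix_vector_mult_def column_def)
qed

text \<open>\<open>\<psi>\<close> is only assumed to list eigenvalues on \<open>carrier G\<close>;
  that they are multiplicative and nonzero follows because the columns of \<open>P\<close> are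
  nonzero.\<close>

locale diagonalized_rep = matrix_rep G A
  for G :: "('a, 'b) monoid_scheme" (structure)
    and A :: "'a \<Rightarrow> (('k::field, 'n::{finite,linorder}) vec, 'n) vec" +
  fixes \<iota> :: "'k \<Rightarrow> 'K::field" and P :: "(('K, 'n) vec, 'n) vec" and \<psi> :: "'n \<Rightarrow> 'a \<Rightarrow> 'K"
  assumes \<iota>: "is_ring_hom \<iota>" and P: "invertible P"
    and eigen: "\<And>g i. g \<in> carrier G \<Longrightarrow> map_matrix \<iota> (A g) *v column i P = \<psi> i g *s column i P"
begin

lemma column_nonzero: "column i P \<noteq> 0"
proof
  assume "column i P = 0"
  then have "P *v axis i 1 = P *v 0" by (simp add: matrix_vector_mult_axis)
  moreover obtain Q where "Q ** P = mat 1" using P by (auto simp: invertible_def)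
  ultimately have "axis i 1 = (0 :: ('K, 'n) vec)"
    by (metis matrix_vector_mul_assoc matrix_vector_mul_lid)
  then show False by simp
qed

lemma \<psi>_mult:
  assumes "g \<in> carrier G" "h \<in> carrier G" shows "\<psi> i (g \<otimes> h) = \<psi> i g * \<psi> i h"
proof -
  have "map_matrix \<iota> (A (g \<otimes> h)) = map_matrix \<iota> (A g) ** map_matrix \<iota> (A h)"
    using assms by (simp add: A_mult vec_eq_iff matrix_matrix_mult_def is_ring_hom_sum[OF \<iota>] is_ring_hom_simps[OF \<iota>])
  then have "\<psi> i (g \<otimes> h) *s column i P = map_matrix \<iota> (A g) *v (map_matrix \<iota> (A h) *v column i P)"
    using eigen[of "g \<otimes> h" i] assms by (simp add: matrix_vector_mul_assoc)
  also have "\<dots> = (\<psi> i g * \<psi> i h) *s column i P"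
    using assms by (simp add: eigen vec.scale mult.commute)
  finally show ?thesis using column_nonzero by (simp add: vec.scale_right_imp_eq)
qed

lemma \<psi>_one: "\<psi> i \<one> = 1"
proof -
  have "map_matrix \<iota> (A \<one>) = mat 1"
    by (simp add: A_one vec_eq_iff mat_def is_ring_hom_simps[OF \<iota>])
  then have "\<psi> i \<one> *s column i P = 1 *s column i P"
    using eigen[OF one_closed, of i] by simp
  then show ?thesis by (rule vec.scale_right_imp_eq[OF column_nonzero])
qed

lemma \<psi>_nonzero: "g \<in> carrier G \<Longrightarrow> \<psi> i g \<noteq> 0"
  using \<psi>_mult[of g "inv g" i] \<psi>_one by auto

abbreviation \<phi> where "\<phi> \<equiv> base_change \<iota> P"

text \<open>The eigenvector equations for \<open>inv g\<close> say that its matrix times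
  \<open>P\<close> is \<open>P\<close> times a diagonal matrix, so the substitution becomes a
  rescaling of the new variables.\<close>

lemma base_change_poly_act:
  assumes g: "g \<in> carrier G"
  shows "\<phi> (poly_act G A g p) = mpoly_eval (\<lambda>c. Const c) (\<lambda>i. Const (\<psi> i (inv g)) * Var i) (\<phi> p)"
proof (rule mpoly_hom_eqI[where f = "\<lambda>p. \<phi> (poly_act G A g p)"
      and g = "\<lambda>p. mpoly_eval (\<lambda>c. Const c) (\<lambda>i. Const (\<psi> i (inv g)) * Var i) (\<phi> p)"])
  let ?s = "mpoly_eval (\<lambda>c. Const c) (\<lambda>i. Const (\<psi> i (inv g)) * Var i) :: ('n, 'K) mpoly \<Rightarrow> ('n, 'K) mpoly"
  note h\<phi> = base_change_hom[OF \<iota>, of P]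
  note C = is_ring_hom_Const[where 'k = 'K and 'n = 'n]
  note hs = mpoly_eval_hom[OF C]
  show "is_ring_hom (\<lambda>p. \<phi> (poly_act G A g p))" "is_ring_hom (\<lambda>p. ?s (\<phi> p))"
    by (rule is_ring_hom_comp[OF h\<phi> poly_act_hom] is_ring_hom_comp[OF hs h\<phi>])+
  show "\<phi> (poly_act G A g (Const c)) = ?s (\<phi> (Const c))" for c
    by (simp add: poly_act_Const base_change_Const[OF \<iota>] mpoly_eval_Const[OF C])
  fix j
  have "(\<Sum>l\<in>UNIV. \<iota> (A (inv g) $ j $ l) * P $ l $ i) = \<psi> i (inv g) * P $ j $ i" for i
    using arg_cong[OF eigen[of "inv g" i], of "\<lambda>v. v $ j"] g by (simp add: matrix_vector_mult_def column_def)
  then have e: "(\<Sum>l\<in>UNIV. Const (\<iota> (A (inv g) $ j $ l)) * Const (P $ l $ i))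
      = (Const (\<psi> i (inv g) * P $ j $ i) :: ('n, 'K) mpoly)" for i
    by (metis (mono_tags, lifting) is_ring_hom_simps(4)[OF C] is_ring_hom_sum[OF C] sum.cong)
  have "\<phi> (poly_act G A g (Var j))
      = (\<Sum>l\<in>UNIV. \<Sum>i\<in>UNIV. Const (\<iota> (A (inv g) $ j $ l)) * Const (P $ l $ i) * Var i)"
    by (simp add: poly_act_Var is_ring_hom_sum[OF h\<phi>] is_ring_hom_simps[OF h\<phi>]
        base_change_Const[OF \<iota>] base_change_Var[OF \<iota>] sum_distrib_left mult.assoc)
  also have "\<dots> = (\<Sum>i\<in>UNIV. Const (\<psi> i (inv g) * P $ j $ i) * Var i)"
    by (subst sum.swap) (simp add: e sum_distrib_right[symmetric])
  also have "\<dots> = ?s (\<phi> (Var j))"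
    by (simp add: base_change_Var[OF \<iota>] is_ring_hom_sum[OF hs] is_ring_hom_simps[OF hs]
        mpoly_eval_Const[OF C] mpoly_eval_Var[OF C] is_ring_hom_simps[OF C] mult_ac)
  finally show "\<phi> (poly_act G A g (Var j)) = ?s (\<phi> (Var j))" .
qed

lemma lookup_base_change_poly_act:
  "g \<in> carrier G \<Longrightarrow> Poly_Mapping.lookup (\<phi> (poly_act G A g p)) t
    = Poly_Mapping.lookup (\<phi> p) t * (\<Prod>i\<in>UNIV. \<psi> i (inv g) ^ Poly_Mapping.lookup t i)"
  by (simp add: base_change_poly_act mpoly_eval_scaled_vars[OF is_ring_hom_id])

text \<open>The scalars of the action are nonzero. Hence all translates of a polynomial have the
  same top weight, whatever the weights are.\<close>

lemma keys_base_change_poly_act: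
  "g \<in> carrier G \<Longrightarrow> Poly_Mapping.keys (\<phi> (poly_act G A g p)) = Poly_Mapping.keys (\<phi> p)"
  by (auto simp: in_keys_iff lookup_base_change_poly_act \<psi>_nonzero)

lemma invariant_monomial:
  assumes "\<And>g. g \<in> carrier G \<Longrightarrow> poly_act G A g p = p"
    and "t \<in> Poly_Mapping.keys (\<phi> p)" and "g \<in> carrier G"
  shows "(\<Prod>i\<in>UNIV. \<psi> i g ^ Poly_Mapping.lookup t i) = 1"
  using lookup_base_change_poly_act[of "inv g" p t] assms by (simp add: in_keys_iff)

text \<open>\<open>T\<close> collects indices with trivial character, and \<open>r\<close> maps
  every other index to a representative in \<open>J\<close> with the same character. Thus the
  exponent can count characters rather than coordinates.\<close>

lemma card_le_power_of_field_degree: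
  assumes fin: "ring.finite_dimension ring_of_type_algebra
      (field_gen (poly_invariants_le G A d)) (rational_invariants G A)"
    and r: "\<And>i. i \<notin> T \<Longrightarrow> r i \<in> J" "\<And>i g. i \<notin> T \<Longrightarrow> g \<in> carrier G \<Longrightarrow> \<psi> (r i) g = \<psi> i g"
    and T: "\<And>i g. i \<in> T \<Longrightarrow> g \<in> carrier G \<Longrightarrow> \<psi> i g = 1"
    and J: "\<And>j. j \<in> J \<Longrightarrow> r j = j \<and> j \<notin> T"
    and sep: "\<And>g h. g \<in> carrier G \<Longrightarrow> h \<in> carrier G \<Longrightarrow> g \<noteq> h \<Longrightarrow> \<exists>i\<in>J. \<psi> i g \<noteq> \<psi> i h"
  shows "card (carrier G) \<le> d ^ card J"
proof (rule ccontr)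
  assume "\<not> card (carrier G) \<le> d ^ card J"
  then have less: "d ^ card J < card (carrier G)" by simp
  have "\<exists>w :: 'n \<Rightarrow> real. (\<exists>i\<in>J. w i > 0) \<and>
    (\<forall>a. (\<forall>i. i \<notin> J \<longrightarrow> a i = 0) \<longrightarrow> sum a J \<le> d \<longrightarrow> (\<forall>g\<in>carrier G. (\<Prod>i\<in>J. \<psi> i g ^ a i) = 1)
      \<longrightarrow> (\<Sum>i\<in>J. w i * real (a i)) = 0)"
    by (rule exists_orthogonal_weight[OF finite_G _ less]) (rule sep)
  then obtain w :: "'n \<Rightarrow> real" where "\<exists>i\<in>J. w i > 0"
    and w: "\<forall>a. (\<forall>i. i \<notin> J \<longrightarrow> a i = 0) \<longrightarrow> sum a J \<le> d \<longrightarrow>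
      (\<forall>g\<in>carrier G. (\<Prod>i\<in>J. \<psi> i g ^ a i) = 1) \<longrightarrow> (\<Sum>i\<in>J. w i * real (a i)) = 0"
    by (elim exE conjE)
  then obtain i0 where i0: "i0 \<in> J" "w i0 > 0" by blast
  \<comment> \<open>The weight of a monomial now depends only on its exponents collected by
    nontrivial character.\<close>
  define v where "v i = (if i \<in> T then 0 else w (r i))" for i
  have inj: "inj \<phi>" by (rule inj_base_change[OF \<iota> P])
  interpret graded_embedding \<phi> v
    by unfold_locales (rule base_change_hom[OF \<iota>] inj)+
  have group: "(\<Sum>j\<in>J. \<Sum>i\<in>{i \<in> - T. r i = j}. f i) = sum f (- T)" for f :: "'n \<Rightarrow> 'x::comm_monoid_add"
    using r(1) by (intro sum.group) auto
  have pgroup: "(\<Prod>j\<in>J. \<Prod>i\<in>{i \<in> - T. r i = j}. f i) = prod f (- T)" for f :: "'n \<Rightarrow> 'K"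
    using r(1) by (intro prod.group) auto
  have wl: "weightless v (\<phi> p)" if p: "p \<in> range Const \<union> poly_invariants_le G A d" for p
    using p
  proof
    assume "p \<in> range Const"
    then obtain c where "\<phi> p = Const (\<iota> c)" using base_change_Const[OF \<iota>] by blast
    then show ?thesis
      by (simp add: weightless_def Const_def weight_def)
  next
    assume "p \<in> poly_invariants_le G A d"
    then have pinv: "\<And>g. g \<in> carrier G \<Longrightarrow> poly_act G A g p = p" and deg: "total_degree_le d p"
      by (auto simp: poly_invariants_le_def)
    \<comment> \<open>The new variables enter linearly, so the degree does not grow.\<close>
    have deg\<phi>: "total_degree_le d (\<phi> p)"
      unfolding base_change_def by (intro total_degree_le_mpoly_eval deg total_degree_le_linear_form)
    show ?thesis
      unfolding weightless_def
    proof
      fix t assume t: "t \<in> Poly_Mapping.keys (\<phi> p)"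
      let ?t = "Poly_Mapping.lookup t"
      \<comment> \<open>Adding up the exponents of each character keeps the monomial function and
        does not raise the degree; this brings \<open>t\<close> into the range of
        \<open>w\<close>.\<close>
      define a where "a j = (\<Sum>i\<in>{i \<in> - T. r i = j}. ?t i)" for j
      have "(\<Sum>j\<in>J. w j * real (a j)) = 0"
      proof (rule w[rule_format])
        fix j assume "j \<notin> J"
        then have "{i \<in> - T. r i = j} = {}" using r(1) by auto
        then show "a j = 0" by (simp only: a_def sum.empty)
      next
        have "sum a J = (\<Sum>i\<in>- T. ?t i)" unfolding a_def by (rule group)
        also have "\<dots> \<le> (\<Sum>i\<in>UNIV. ?t i)" by (intro sum_mono2) auto
        also have "\<dots> \<le> d" using deg\<phi> t by (auto simp: total_degree_le_def)
        finally show "sum a J \<le> d" .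
      next
        fix g assume g: "g \<in> carrier G"
        have "(\<Prod>j\<in>J. \<psi> j g ^ a j) = (\<Prod>j\<in>J. \<Prod>i\<in>{i \<in> - T. r i = j}. \<psi> i g ^ ?t i)"
          unfolding a_def power_sum using r(2) g by (intro prod.cong) auto
        also have "\<dots> = (\<Prod>i\<in>- T. \<psi> i g ^ ?t i)" by (rule pgroup)
        also have "\<dots> = (\<Prod>i\<in>UNIV. \<psi> i g ^ ?t i)"
          using T g by (intro prod.mono_neutral_left) auto
        also have "\<dots> = 1" by (rule invariant_monomial[OF pinv t g])
        finally show "(\<Prod>j\<in>J. \<psi> j g ^ a j) = 1" .
      qed
      also have "(\<Sum>j\<in>J. w j * real (a j)) = (\<Sum>j\<in>J. \<Sum>i\<in>{i \<in> - T. r i = j}. v i * real (?t i))"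
        unfolding a_def by (simp add: sum_distrib_left v_def)
      also have "\<dots> = (\<Sum>i\<in>- T. v i * real (?t i))" by (rule group)
      also have "\<dots> = weight v t"
        unfolding weight_def by (intro sum.mono_neutral_left) (auto simp: v_def)
      finally show "weight v t = 0" .
    qed
  qed
  \<comment> \<open>A coordinate function over \<open>k\<close> in which the eigencoordinate
    \<open>i0\<close> of positive weight really occurs.\<close>
  obtain j where j: "P $ j $ i0 \<noteq> 0"
    using column_nonzero[of i0] by (auto simp: vec_eq_iff column_def)
  \<comment> \<open>The norm is invariant and defined over \<open>k\<close>; its factors contribute
    equal positive top weights.\<close>
  define f where "f = (\<Prod>g\<in>carrier G. poly_act G A g (Var j))"
  have nz: "\<phi> (poly_act G A g (Var j)) \<noteq> 0" if "g \<in> carrier G" for g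
    using keys_base_change_poly_act[OF that, of "Var j"] j lookup_base_change_Var[OF \<iota>, of P j i0]
    by (metis keys_eq_empty lookup_zero)
  have "weight v (Poly_Mapping.single i0 1) > 0"
  proof -
    have "weight v (Poly_Mapping.single i0 1) = (\<Sum>i\<in>UNIV. if i = i0 then v i0 else 0)"
      unfolding weight_def by (intro sum.cong) (auto simp: lookup_single when_def)
    then show ?thesis using i0 J by (simp add: v_def)
  qed
  moreover have "weight v (Poly_Mapping.single i0 1) \<le> top_weight v (\<phi> (Var j))"
    using j lookup_base_change_Var[OF \<iota>, of P j i0] by (intro weight_le_top) (simp add: in_keys_iff)
  ultimately have pos: "top_weight v (\<phi> (Var j)) > 0" by simp
  have "top_weight v (\<phi> f) = (\<Sum>g\<in>carrier G. top_weight v (\<phi> (poly_act G A g (Var j))))"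
    unfolding f_def is_ring_hom_prod[OF hom] by (rule top_weight_prod[OF finite_G nz])
  also have "\<dots> = (\<Sum>g\<in>carrier G. top_weight v (\<phi> (Var j)))"
    by (intro sum.cong) (simp_all add: top_weight_def keys_base_change_poly_act)
  finally have "top_weight v (\<phi> f) > 0"
    using pos finite_G carrier_not_empty by (simp add: card_gt_0_iff)
  moreover have "poly_act G A g (Var j) \<noteq> 0" if "g \<in> carrier G" for g
    using nz[OF that] is_ring_hom_simps(1)[OF hom] by metis
  then have "f \<noteq> 0"
    unfolding f_def using finite_G by (simp add: prod_zero_iff)
  ultimately have "ring.transcendental ring_of_type_algebra (field_gen (poly_invariants_le G A d)) (Fract f 1)"
    using wl by (intro transcendental_if_positive_weight) auto
  moreover have "Fract f 1 \<in> rational_invariants G A"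
  proof (rule Fract_rational_invariant)
    fix h assume h: "h \<in> carrier G"
    have "poly_act G A h f = (\<Prod>g\<in>carrier G. poly_act G A (h \<otimes> g) (Var j))"
      unfolding f_def is_ring_hom_prod[OF poly_act_hom] using h by (intro prod.cong) (auto simp: poly_act_mult)
    also have "\<dots> = f"
      unfolding f_def
      by (rule prod.reindex_bij_witness[of _ "\<lambda>g. inv h \<otimes> g" "\<lambda>g. h \<otimes> g"])
         (use h in \<open>auto simp: m_assoc[symmetric]\<close>)
    finally show "poly_act G A h f = f" .
  qed
  ultimately show False
    using ring.finite_dimension_imp_algebraic[OF ring_from_type_algebra subfield_field_gen
        subfieldE(1)[OF subfield_rational_invariants] fin]
    by (simp add: over_def)
qed

end

section \<open>Matrices with respect to a basis\<close>

context
  fixes sc :: "'k::field \<Rightarrow> 'v::ab_group_add \<Rightarrow> 'v" and b :: "'n::finite \<Rightarrow> 'v"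
  assumes V: "finite_dimensional_vector_space sc (range b)" and inj_b: "inj b"
begin

interpretation finite_dimensional_vector_space sc "range b" by (rule V)

lemma matrix_wrt_column: "f (b j) = (\<Sum>i\<in>UNIV. sc (matrix_wrt sc b f $ i $ j) (b i))"
proof -
  have "(\<Sum>v\<in>range b. sc (representation (range b) (f (b j)) v) v) = f (b j)"
    by (rule sum_representation_eq) (auto simp: independent_Basis span_Basis)
  then show ?thesis
    using inj_b by (simp add: sum.reindex matrix_wrt_def)
qed

lemma matrix_wrt_unique:
  assumes "\<And>j. f (b j) = (\<Sum>i\<in>UNIV. sc (M $ i $ j) (b i))"
  shows "matrix_wrt sc b f = M"
proof -
  have "representation (range b) (f (b j)) (b i) = M $ i $ j" for i j
  proof -
    have "representation (range b) (f (b j)) (b i) = (\<Sum>l\<in>UNIV. M $ l $ j * (if b i = b l then 1 else 0))"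
      unfolding assms
      by (simp add: representation_sum representation_scale representation_basis independent_Basis span_Basis)
    also have "\<dots> = (\<Sum>l\<in>UNIV. if l = i then M $ i $ j else 0)"
      using inj_b by (intro sum.cong) (auto simp: inj_eq)
    finally show ?thesis by simp
  qed
  then show ?thesis by (simp add: matrix_wrt_def vec_eq_iff)
qed

lemma matrix_wrt_comp:
  assumes "Vector_Spaces.linear sc sc f"
  shows "matrix_wrt sc b (\<lambda>x. f (h x)) = matrix_wrt sc b f ** matrix_wrt sc b h"
proof (rule matrix_wrt_unique)
  interpret f: Vector_Spaces.linear sc sc f by fact
  fix j
  have "f (h (b j)) = (\<Sum>l\<in>UNIV. sc (matrix_wrt sc b h $ l $ j) (f (b l)))"
    by (subst matrix_wrt_column) (simp add: f.sum f.scale)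
  also have "\<dots> = (\<Sum>l\<in>UNIV. \<Sum>i\<in>UNIV. sc (matrix_wrt sc b h $ l $ j * matrix_wrt sc b f $ i $ l) (b i))"
    by (subst matrix_wrt_column[of f]) (simp add: scale_sum_right)
  also have "\<dots> = (\<Sum>i\<in>UNIV. sc ((matrix_wrt sc b f ** matrix_wrt sc b h) $ i $ j) (b i))"
    by (subst sum.swap) (simp add: matrix_matrix_mult_def scale_sum_left mult.commute)
  finally show "f (h (b j)) = \<dots>" .
qed

lemma matrix_wrt_id: "matrix_wrt sc b (\<lambda>x. x) = mat 1"
proof (rule matrix_wrt_unique)
  fix j
  have "(\<Sum>i\<in>UNIV. sc (mat 1 $ i $ j) (b i)) = (\<Sum>i\<in>UNIV. if i = j then b j else 0)"
    by (intro sum.cong) (auto simp: mat_def)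
  then show "b j = (\<Sum>i\<in>UNIV. sc (mat 1 $ i $ j) (b i))" by simp
qed

text \<open>Both maps are determined by their values on the basis. Faithfulness of the action
  thereby carries over to the matrices.\<close>

lemma matrix_wrt_inject:
  assumes f: "Vector_Spaces.linear sc sc f" and h: "Vector_Spaces.linear sc sc h"
    and eq: "matrix_wrt sc b f = matrix_wrt sc b h"
  shows "f = h"
proof
  fix x
  interpret f: Vector_Spaces.linear sc sc f by fact
  interpret h: Vector_Spaces.linear sc sc h by fact
  have "f (b j) = h (b j)" for j
    using matrix_wrt_column[of f j] matrix_wrt_column[of h j] eq by simp
  moreover have "(\<Sum>v\<in>range b. sc (representation (range b) x v) v) = x"
    by (rule sum_representation_eq) (auto simp: independent_Basis span_Basis)
  then have "x = (\<Sum>i\<in>UNIV. sc (representation (range b) x (b i)) (b i))"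
    using inj_b by (simp add: sum.reindex)
  ultimately show "f x = h x"
    by (metis (no_types, lifting) f.scale f.sum h.scale h.sum sum.cong)
qed

end

section \<open>Representatives of the characters, and the bound\<close>

theorem theorem3p1:
  fixes G :: "('g, 'c) monoid_scheme"
    and sc :: "'k::field \<Rightarrow> 'v::ab_group_add \<Rightarrow> 'v"
    and b :: "'n::{finite,linorder} \<Rightarrow> 'v"
    and \<rho> :: "'g \<Rightarrow> 'v \<Rightarrow> 'v"
    and \<iota> :: "'k \<Rightarrow> 'K::field"
    and m :: nat
  assumes "comm_group G" and "finite (carrier G)"
    and "\<not> CHAR('k) dvd card (carrier G)"
    and "finite_dimensional_vector_space sc (range b)" and "inj b"
    and "faithful_action G UNIV \<rho>"
    and "\<And>g. g \<in> carrier G \<Longrightarrow> Vector_Spaces.linear sc sc (\<rho> g)"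
    and "\<iota> \<in> ring_hom ring_of_type_algebra ring_of_type_algebra"
    and "card {z::'K. z ^ card (carrier G) = 1} = card (carrier G)"
    and "m = card (nontrivial_characters_in G \<iota> (\<lambda>g. matrix_wrt sc b (\<rho> g)))"
    and "m \<ge> 1"
  shows "real (gamma_field G (\<lambda>g. matrix_wrt sc b (\<rho> g))) \<ge> root m (real (card (carrier G)))"
proof -
  interpret comm_group G by fact
  interpret act: faithful_action G UNIV \<rho> by fact
  note V = assms(4,5)
  define A where "A = (\<lambda>g. matrix_wrt sc b (\<rho> g))"
  define N where "N = card (carrier G)"
  \<comment> \<open>\<open>ring_hom\<close> does not mention 0; its preservation is derived from
    additivity.\<close>
  have \<iota>: "is_ring_hom \<iota>"
  proof -
    have add: "\<iota> (x + y) = \<iota> x + \<iota> y" for x y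
      using assms(8) by (simp add: ring_hom_def)
    have "\<iota> 0 + \<iota> 0 = \<iota> 0 + 0" using add[of 0 0, symmetric] by simp
    then have "\<iota> 0 = 0" by (rule add_left_imp_eq)
    then show ?thesis
      using assms(8) add by (simp add: ring_hom_def is_ring_hom_def)
  qed
  have rep_mult: "\<rho> (g \<otimes>\<^bsub>G\<^esub> h) = (\<lambda>x. \<rho> g (\<rho> h x))" if "g \<in> carrier G" "h \<in> carrier G" for g h
    using act.composition_rule[OF _ that] by auto
  have rep_one: "\<rho> \<one>\<^bsub>G\<^esub> = (\<lambda>x. x)"
    using act.id_eq_one[symmetric] by (simp add: restrict_def)
  interpret rep: matrix_rep G A
  proof unfold_locales
    show "A (g \<otimes>\<^bsub>G\<^esub> h) = A g ** A h" if "g \<in> carrier G" "h \<in> carrier G" for g h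
      unfolding A_def rep_mult[OF that] by (rule matrix_wrt_comp[OF V assms(7)[OF that(1)]])
    show "A \<one>\<^bsub>G\<^esub> = mat 1"
      unfolding A_def rep_one by (rule matrix_wrt_id[OF V])
    show "finite (carrier G)" by fact
  qed
  have injA: "g = h" if "g \<in> carrier G" "h \<in> carrier G" "A g = A h" for g h
    using matrix_wrt_inject[OF V assms(7) assms(7), of g h] that act.faithful by (auto simp: A_def inj_on_def)
  \<comment> \<open>The Fourier decomposition divides by the group order in \<open>K\<close>; the
    embedding keeps it nonzero.\<close>
  have N_nonzero: "(of_nat N :: 'K) \<noteq> 0"
  proof -
    have of_nat: "\<iota> (of_nat n) = of_nat n" for n
      by (induction n) (simp_all add: is_ring_hom_simps[OF \<iota>])
    have "(of_nat N :: 'k) \<noteq> 0"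
      using assms(3) by (simp add: N_def of_nat_eq_0_iff_char_dvd)
    then show ?thesis
      using is_ring_hom_field_inj[OF \<iota>] of_nat is_ring_hom_simps(1)[OF \<iota>] by (metis injD)
  qed
  obtain P :: "(('K, 'n) vec, 'n) vec" and \<psi> where diag: "invertible P"
    "\<And>g i. g \<in> carrier G \<Longrightarrow> map_matrix \<iota> (A g) *v column i P = \<psi> i g *s column i P"
  proof (rule common_eigenbasis[where A = "\<lambda>g. map_matrix \<iota> (A g)", OF assms(1,2,9)])
    show "of_nat (card (carrier G)) \<noteq> (0 :: 'K)"
      using N_nonzero by (simp add: N_def)
    show "map_matrix \<iota> (A (g \<otimes>\<^bsub>G\<^esub> h)) = map_matrix \<iota> (A g) ** map_matrix \<iota> (A h)"
      if "g \<in> carrier G" "h \<in> carrier G" for g h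
      using that by (simp add: rep.A_mult vec_eq_iff matrix_matrix_mult_def
          is_ring_hom_sum[OF \<iota>] is_ring_hom_simps[OF \<iota>])
    show "map_matrix \<iota> (A \<one>\<^bsub>G\<^esub>) = mat 1"
      by (simp add: rep.A_one vec_eq_iff mat_def is_ring_hom_simps[OF \<iota>])
    fix P' :: "(('K, 'n) vec, 'n) vec" and \<psi>'
    assume "invertible P'"
      "\<And>g i. g \<in> carrier G \<Longrightarrow> map_matrix \<iota> (A g) *v column i P' = \<psi>' i g *s column i P'"
    then show thesis by (intro that[of P' \<psi>']) auto
  qed
  interpret diagonalized_rep G A \<iota> P \<psi>
    by unfold_locales (use \<iota> diag in auto)
  \<comment> \<open>Restriction makes the eigenvalue functions extensional, so that equal characters
    are equal functions.\<close>
  define \<xi> where "\<xi> i = restrict (\<psi> i) (carrier G)" for i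
  define r where "r i = (SOME j. \<xi> j = \<xi> i)" for i
  have \<xi>r: "\<xi> (r i) = \<xi> i" for i
    unfolding r_def by (rule someI[of "\<lambda>j. \<xi> j = \<xi> i"]) simp
  have r_cong: "r i = r j" if "\<xi> i = \<xi> j" for i j
    using that by (simp add: r_def)
  have \<xi>_eqD: "\<psi> i g = \<psi> j g" if "\<xi> i = \<xi> j" "g \<in> carrier G" for i j g
    using fun_cong[OF that(1), of g] that(2) by (simp add: \<xi>_def)
  define T where "T = {i. \<xi> i = (\<lambda>g\<in>carrier G. 1)}"
  have T_one: "\<psi> i g = 1" if "i \<in> T" "g \<in> carrier G" for i g
  proof -
    have "\<xi> i = (\<lambda>g\<in>carrier G. 1)" using that(1) by (simp add: T_def)
    from fun_cong[OF this, of g] show ?thesis using that(2) by (simp add: \<xi>_def)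
  qed
  define J where "J = r ` (- T)"
  have J: "r j = j \<and> j \<notin> T" if j: "j \<in> J" for j
  proof -
    obtain i where i: "j = r i" "i \<notin> T" using j by (auto simp: J_def)
    then show ?thesis using \<xi>r[of i] r_cong[OF \<xi>r[of i]] by (simp add: T_def)
  qed
  let ?X = "nontrivial_characters_in G \<iota> A"
  \<comment> \<open>An infinite set would have cardinality 0, against
    \<open>m \<ge> 1\<close>.\<close>
  have "finite ?X"
    using assms(10,11) card_ge_0_finite[of ?X] by (simp add: A_def)
  moreover have "\<xi> ` J \<subseteq> ?X"
  proof
    fix \<eta> assume "\<eta> \<in> \<xi> ` J"
    then obtain j where j: "\<eta> = \<xi> j" "j \<notin> T" using J by blast
    have "\<xi> j \<in> characters G"
      by (auto simp: characters_def hom_def \<xi>_def \<psi>_mult \<psi>_nonzero)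
    moreover have "occurs_in G \<iota> A (\<xi> j)"
      unfolding occurs_in_def using column_nonzero diag(2) by (intro exI[of _ "column j P"]) (simp add: \<xi>_def)
    ultimately show "\<eta> \<in> ?X"
      using j by (simp add: nontrivial_characters_in_def T_def)
  qed
  moreover have "inj_on \<xi> J"
  proof (rule inj_onI)
    fix i j assume ij: "i \<in> J" "j \<in> J" "\<xi> i = \<xi> j"
    have "r i = r j" by (rule r_cong[OF ij(3)])
    then show "i = j" using J[OF ij(1)] J[OF ij(2)] by (elim conjE) (simp only:)
  qed
  ultimately have "card J \<le> card ?X"
    by - (rule card_inj_on_le)
  then have cardJ: "card J \<le> m"
    using assms(10) by (simp add: A_def)
  \<comment> \<open>If all characters in \<open>J\<close> agree at \<open>g\<close> and
    \<open>h\<close>, so do all eigenvalues, hence the matrices, and faithfulness gives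
    \<open>g = h\<close>.\<close>
  have sep: "\<exists>i\<in>J. \<psi> i g \<noteq> \<psi> i h" if gh: "g \<in> carrier G" "h \<in> carrier G" "g \<noteq> h" for g h
  proof (rule ccontr)
    assume "\<not> (\<exists>i\<in>J. \<psi> i g \<noteq> \<psi> i h)"
    then have J_eq: "\<psi> i g = \<psi> i h" if "i \<in> J" for i using that by blast
    have \<psi>_eq: "\<psi> i g = \<psi> i h" for i
    proof (cases "i \<in> T")
      case True
      then show ?thesis
        using T_one gh by simp
    next
      case False
      then show ?thesis
        using J_eq[of "r i"] \<xi>_eqD[OF \<xi>r] gh by (auto simp: J_def)
    qed
    have "map_matrix \<iota> (A g) ** P = map_matrix \<iota> (A h) ** P"
    proof -
      have "column i (map_matrix \<iota> (A g) ** P) = column i (map_matrix \<iota> (A h) ** P)" for i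
        using diag(2)[OF gh(1), of i] diag(2)[OF gh(2), of i] \<psi>_eq[of i]
        by (metis matrix_vector_mul_assoc matrix_vector_mult_axis)
      then show ?thesis by (simp add: vec_eq_iff column_def)
    qed
    moreover obtain Q where "P ** Q = mat 1" using diag(1) by (auto simp: invertible_def)
    ultimately have "map_matrix \<iota> (A g) = map_matrix \<iota> (A h)"
      by (metis matrix_mul_assoc matrix_mul_rid)
    then have "A g = A h"
      using is_ring_hom_field_inj[OF \<iota>] by (simp add: vec_eq_iff inj_eq)
    then show False using injA gh by blast
  qed
  define d where "d = gamma_field G A"
  have "ring.finite_dimension ring_of_type_algebra
      (field_gen (poly_invariants_le G A d)) (rational_invariants G A)"
    unfolding d_def gamma_field_def by (rule LeastI[of _ N]) (use rep.finite_dimension_card in \<open>simp add: N_def\<close>)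
  then have bound: "N \<le> d ^ card J"
    unfolding N_def
  proof (rule card_le_power_of_field_degree)
    show "r i \<in> J" if "i \<notin> T" for i using that by (simp add: J_def)
    show "\<psi> (r i) g = \<psi> i g" if "g \<in> carrier G" for i g using \<xi>_eqD[OF \<xi>r that] .
    show "\<psi> i g = 1" if "i \<in> T" "g \<in> carrier G" for i g using that by (rule T_one)
    show "j \<in> J \<Longrightarrow> r j = j \<and> j \<notin> T" for j by (rule J)
  qed (rule sep)
  have "N \<ge> 1"
    using assms(2) one_closed by (auto simp: N_def Suc_le_eq card_gt_0_iff)
  \<comment> \<open>With \<open>J\<close> empty nothing separates points, so \<open>G\<close> is
    trivial and has no nontrivial character. The case must be excluded because
    \<open>0 ^ 0 = 1\<close> would allow \<open>d = 0\<close>.\<close>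
  have "J \<noteq> {}"
  proof
    assume "J = {}"
    then have triv: "carrier G = {\<one>\<^bsub>G\<^esub>}" using sep by fastforce
    have "\<eta> = (\<lambda>g\<in>carrier G. 1)" if "\<eta> \<in> characters G" for \<eta> :: "'g \<Rightarrow> 'K"
    proof -
      have ext: "\<eta> \<in> extensional (carrier G)" and "\<eta> \<one>\<^bsub>G\<^esub> \<noteq> 0"
        using that one_closed by (auto simp: characters_def hom_def Pi_iff)
      moreover have "\<forall>x\<in>carrier G. \<forall>y\<in>carrier G. \<eta> (x \<otimes>\<^bsub>G\<^esub> y) = \<eta> x * \<eta> y"
        using that by (simp add: characters_def hom_def)
      then have "\<eta> (\<one>\<^bsub>G\<^esub> \<otimes>\<^bsub>G\<^esub> \<one>\<^bsub>G\<^esub>) = \<eta> \<one>\<^bsub>G\<^esub> * \<eta> \<one>\<^bsub>G\<^esub>"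
        using one_closed by blast
      ultimately have "\<eta> \<one>\<^bsub>G\<^esub> = 1" by simp
      then show ?thesis
        using triv by (intro extensionalityI[OF ext]) auto
    qed
    then have "?X = {}" by (auto simp: nontrivial_characters_in_def)
    then show False using assms(10,11) by (simp add: A_def)
  qed
  \<comment> \<open>A positive \<open>d\<close> allows the exponent to be raised from
    \<open>card J\<close> to \<open>m\<close>.\<close>
  then have "d \<noteq> 0"
    using bound \<open>N \<ge> 1\<close> by (cases "d = 0") (auto simp: zero_power card_gt_0_iff)
  then have "N \<le> d ^ m"
    using bound power_increasing[OF cardJ, of d] by linarith
  then have "real N \<le> real d ^ m"
    by (metis of_nat_le_iff of_nat_power)
  then have "root m (real N) \<le> root m (real d ^ m)"
    using assms(11) by simp
  also have "\<dots> = real d" using assms(11) by (simp add: real_root_power_cancel)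
  finally show ?thesis by (simp add: N_def d_def A_def)
qed

end
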